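(* Consider a quadratic network utility maximization problem and let $\mathcal{Q}$ be any zoom-in quantization scheme with $\rho=\delta^{\max}_k/\delta^{\min}_k$ for all $k$, where $\delta^{\max}_k$ and $\delta^{\min}_k$ are the maximum and minimum quantization steps under $\mathcal{Q}$ at time $k$. Let $\mathrm{B}\subset\mathbb{R}^{N+M}$ be the (axis-parallel) box centered at the origin with $i$th side length $4\rho|T_{ii}|+2\|T\|_\infty$, and let $\beta_T$ be the number of elements of $\mathrm{B}\cap T\mathbb{Z}^{N+M}$, where $T\mathbb{Z}^{N+M}=\{T\boldsymbol{I}:\boldsymbol{I}\in\mathbb{Z}^{N+M}\}$. Then $$\liminf_{k\to\infty}\frac{1}{k+1}\log\mathsf{E}\left[\|\boldsymbol{\epsilon}_{k+1}\|_2^2\right]\ \ge\ -\frac{2}{M+N}\log\left(\frac{\beta_T}{\prod_{i=1}^{M+N}|T_{ii}|}\right),$$ where $\boldsymbol{\epsilon}_k=\boldsymbol{y}_k-\boldsymbol{y}^\star$.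
   Context: **Problem.** Let $N<M$ be positive integers, $A\in\mathbb{R}^{N\times M}$, $\boldsymbol{b}\in\mathbb{R}^N$. Quadratic NUM problem: maximize $\sum_{i=1}^M U_i(x^i)$ subject to $A\boldsymbol{x}=\boldsymbol{b}$, with $U_i(x)=-\frac{a_i}{2}x^2+c_ix+f_i$, $a_i>0$. $\boldsymbol{y}^\star\in\mathbb{R}^{M+N}$ is the concatenation of the optimal primal and dual solutions $\boldsymbol{x}^\star,\boldsymbol{\lambda}^\star$. The step size is a constant $\mu$ with $0<\mu\le\min_i 1/a_i$. Put $$T=\begin{bmatrix}\mathrm{Diag}(1-\mu a_1,\dots,1-\mu a_M)&-\mu A^\top\\ \mu A& I_N\end{bmatrix},$$ so the unquantized primal-dual (PD) algorithm is $\boldsymbol{y}_k=T\boldsymbol{y}_{k-1}+\mu[\boldsymbol{c}^\top,-\boldsymbol{b}^\top]^\top$, $\boldsymbol{y}_k=[\boldsymbol{x}_k^\top,\boldsymbol{\lambda}_k^\top]^\top$. $\|T\|_\infty$ is the induced infinity norm (maximum absolute row sum). **Quantized algorithm.** At each time $k\ge0$, each scalar variable $x^i_k$ (resp. $\lambda^j_k$) is encoded, causally from its own past and present values and its own past symbols, into a symbol $\hat Q^{\boldsymbol{x}}_{i,k}$ (resp. $\hat Q^{\boldsymbol{\lambda}}_{j,k}$) in a finite alphabet, and decoded from its symbols up to time $k$ to a quantized value $Q^{\boldsymbol{x}}_{i,k}$ (resp. $Q^{\boldsymbol{\lambda}}_{j,k}$). With $Q^{\boldsymbol{x}}_k,Q^{\boldsymbol{\lambda}}_k$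 the vectors of these values, and $A_i$, $\bar A_j$ the $i$th column and $j$th row of $A$, $$x^i_{k+1}=(1-\mu a_i)x^i_k+\mu(c_i-A_i^\top Q^{\boldsymbol{\lambda}}_k),\qquad \lambda^j_{k+1}=\lambda^j_k+\mu(\bar A_jQ^{\boldsymbol{x}}_k-b_j).$$ $\tilde Q_k$ is the collection of all symbols (of all variables) up to time $k$, $\tilde q_k$ a realization of it. Given $\tilde q_k$ the quantized values are fixed, and the update is written $\boldsymbol{y}_{k+1}=\hat T(\boldsymbol{y}_k,\tilde q_k)$. $C_k(\tilde q_k)$ denotes the quantization cell corresponding to $\tilde q_k$, i.e. the set of values of $\boldsymbol{y}_k$ corresponding to $\tilde Q_k=\tilde q_k$; the quantized value (cell representative) lies in the cell. The quantization steps at time $k$ are the side lengths of the quantization cells at time $k$ (which are axis-parallel boxes). **Zoom-in scheme.** $\mathcal{Q}$ is zoom-in if for all $k\in\{0,1,2,\dots\}$: if $C_k(\tilde q_k)$ is the cell containing $\boldsymbol{y}_k$, then at time $k+1$ it is the image of $C_k(\tilde q_k)$ under $\hat T(\cdot,\tilde q_k)$ that is quantized (partitioned into cells). **Assumptions.** The initial vectors $\boldsymbol{x}_0,\boldsymbol{\lambda}_0$ are independent random vectors with densities having finite differential entropies; these densities are bounded and have bounded support. $T$ is invertible with all eigenvalues inside the unit circle in the complex plane. A zoom-in scheme is employed and each primal/dual variable is independently quantized (scalar quantization into intervals). Logarithms are natural; if some $T_{ii}=0$ the right-hand side is read as $-\infty$. *)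

theory Defs
  imports "HOL-Probability.Probability"
begin

section \<open>Quadratic network utility maximization\<close>

text \<open>Primal variables are indexed by \<open>'m\<close> (so \<open>M = CARD('m)\<close>), constraints and dual variables by
  \<open>'n\<close> (so \<open>N = CARD('n)\<close>), and primal-dual vectors by the disjoint sum \<open>'m + 'n\<close>.\<close>

record ('m, 'n) qnum =
  qa :: "real ^ 'm"
  qc :: "real ^ 'm"
  qf :: "real ^ 'm"
  qA :: "real ^ 'm ^ 'n"
  qb :: "real ^ 'n"

definition utility :: "('m::finite, 'n::finite) qnum \<Rightarrow> 'm \<Rightarrow> real \<Rightarrow> real" where
  "utility P i x = - (qa P $ i / 2) * x\<^sup>2 + qc P $ i * x + qf P $ i"

definition objective :: "('m::finite, 'n::finite) qnum \<Rightarrow> real ^ 'm \<Rightarrow> real" where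
  "objective P x = (\<Sum>i\<in>UNIV. utility P i (x $ i))"

definition primal_optimal :: "('m::finite, 'n::finite) qnum \<Rightarrow> real ^ 'm \<Rightarrow> bool" where
  "primal_optimal P x \<longleftrightarrow>
     qA P *v x = qb P \<and> (\<forall>x'. qA P *v x' = qb P \<longrightarrow> objective P x' \<le> objective P x)"

text \<open>The sign convention of the multiplier is the one for which primal ascent and dual descent on
  the Lagrangian give the primal-dual iteration below.\<close>

definition lagrangian :: "('m::finite, 'n::finite) qnum \<Rightarrow> real ^ 'm \<Rightarrow> real ^ 'n \<Rightarrow> real" where
  "lagrangian P x l = objective P x - l \<bullet> (qA P *v x - qb P)"

definition dual_function :: "('m::finite, 'n::finite) qnum \<Rightarrow> real ^ 'n \<Rightarrow> ereal" where
  "dual_function P l = (SUP x. ereal (lagrangian P x l))"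

definition dual_optimal :: "('m::finite, 'n::finite) qnum \<Rightarrow> real ^ 'n \<Rightarrow> bool" where
  "dual_optimal P l \<longleftrightarrow> (\<forall>l'. dual_function P l \<le> dual_function P l')"

definition join :: "real ^ 'm \<Rightarrow> real ^ 'n \<Rightarrow> real ^ ('m::finite + 'n::finite)" where
  "join x l = (\<chi> r. case r of Inl i \<Rightarrow> x $ i | Inr j \<Rightarrow> l $ j)"


section \<open>The iteration matrix\<close>

definition pd_matrix ::
    "('m::finite, 'n::finite) qnum \<Rightarrow> real \<Rightarrow> real ^ ('m + 'n) ^ ('m + 'n)" where
  "pd_matrix P \<mu> = (\<chi> r s.
     case r of
       Inl i \<Rightarrow> (case s of Inl i' \<Rightarrow> if i = i' then 1 - \<mu> * qa P $ i else 0
                         | Inr j \<Rightarrow> - \<mu> * qA P $ j $ i)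
     | Inr j \<Rightarrow> (case s of Inl i \<Rightarrow> \<mu> * qA P $ j $ i
                         | Inr j' \<Rightarrow> if j = j' then 1 else 0))"

definition eigenvalue :: "complex ^ 'k ^ 'k \<Rightarrow> complex \<Rightarrow> bool" where
  "eigenvalue A z \<longleftrightarrow> (\<exists>v. v \<noteq> 0 \<and> A *v v = z *s v)"

definition norm_inf :: "real ^ 'k ^ 'k \<Rightarrow> real" where
  "norm_inf A = Max (range (\<lambda>r. \<Sum>s\<in>UNIV. \<bar>A $ r $ s\<bar>))"

definition boxB :: "real ^ 'k ^ 'k \<Rightarrow> real \<Rightarrow> (real ^ 'k) set" where
  "boxB A \<rho> = {v. \<forall>r. \<bar>v $ r\<bar> \<le> (4 * \<rho> * \<bar>A $ r $ r\<bar> + 2 * norm_inf A) / 2}"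

definition image_lattice :: "real ^ 'k ^ 'k \<Rightarrow> (real ^ 'k) set" where
  "image_lattice A = {A *v v | v. \<forall>r. v $ r \<in> \<int>}"

definition beta :: "real ^ 'k ^ 'k \<Rightarrow> real \<Rightarrow> nat" where
  "beta A \<rho> = card (boxB A \<rho> \<inter> image_lattice A)"


section \<open>Quantized primal-dual algorithm\<close>

text \<open>Time is carried by the lengths of the argument lists: at time \<open>k\<close> the encoder of a variable
  receives its \<open>k + 1\<close> past and present values and its \<open>k\<close> past symbols, and the decoder receives
  its \<open>k + 1\<close> symbols so far. The set \<open>region\<close> consists of the initial vectors that the scheme is
  designed for, that is, those that are partitioned into cells at time 0.\<close>

record ('k, 's) scheme =
  region :: "(real ^ 'k) set"
  alphabet :: "'k \<Rightarrow> nat \<Rightarrow> 's set"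
  enc :: "'k \<Rightarrow> real list \<Rightarrow> 's list \<Rightarrow> 's"
  dec :: "'k \<Rightarrow> 's list \<Rightarrow> real"

text \<open>A realization of all symbols up to time \<open>k\<close> is a list of length \<open>k + 1\<close> whose entries
  collect the symbols of all variables at one time.\<close>

definition qvalue :: "('k::finite, 's) scheme \<Rightarrow> ('k \<Rightarrow> 's) list \<Rightarrow> real ^ 'k" where
  "qvalue S q = (\<chi> r. dec S r (map (\<lambda>s. s r) q))"

definition That :: "('m::finite, 'n::finite) qnum \<Rightarrow> real \<Rightarrow> ('m + 'n, 's) scheme \<Rightarrow>
    real ^ ('m + 'n) \<Rightarrow> (('m + 'n) \<Rightarrow> 's) list \<Rightarrow> real ^ ('m + 'n)" where
  "That P \<mu> S y q = (\<chi> r. case r of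
       Inl i \<Rightarrow> (1 - \<mu> * qa P $ i) * y $ Inl i
                 + \<mu> * (qc P $ i - (\<Sum>j\<in>UNIV. qA P $ j $ i * qvalue S q $ Inr j))
     | Inr j \<Rightarrow> y $ Inr j + \<mu> * ((\<Sum>i\<in>UNIV. qA P $ j $ i * qvalue S q $ Inl i) - qb P $ j))"

definition encode :: "('k::finite, 's) scheme \<Rightarrow> (real ^ 'k) list \<Rightarrow> ('k \<Rightarrow> 's) list \<Rightarrow> 'k \<Rightarrow> 's" where
  "encode S ys q = (\<lambda>r. enc S r (map (\<lambda>y. y $ r) ys) (map (\<lambda>s. s r) q))"

primrec history :: "('m::finite, 'n::finite) qnum \<Rightarrow> real \<Rightarrow> ('m + 'n, 's) scheme \<Rightarrow>
    real ^ ('m + 'n) \<Rightarrow> nat \<Rightarrow> (real ^ ('m + 'n)) list \<times> (('m + 'n) \<Rightarrow> 's) list" where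
  "history P \<mu> S y0 0 = ([y0], [encode S [y0] []])"
| "history P \<mu> S y0 (Suc k) =
     (let (ys, q) = history P \<mu> S y0 k; ys' = ys @ [That P \<mu> S (last ys) q]
      in (ys', q @ [encode S ys' q]))"

definition state :: "('m::finite, 'n::finite) qnum \<Rightarrow> real \<Rightarrow> ('m + 'n, 's) scheme \<Rightarrow>
    real ^ ('m + 'n) \<Rightarrow> nat \<Rightarrow> real ^ ('m + 'n)" where
  "state P \<mu> S y0 k = last (fst (history P \<mu> S y0 k))"

definition symbols :: "('m::finite, 'n::finite) qnum \<Rightarrow> real \<Rightarrow> ('m + 'n, 's) scheme \<Rightarrow>
    real ^ ('m + 'n) \<Rightarrow> nat \<Rightarrow> (('m + 'n) \<Rightarrow> 's) list" where
  "symbols P \<mu> S y0 k = snd (history P \<mu> S y0 k)"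

definition cell :: "('m::finite, 'n::finite) qnum \<Rightarrow> real \<Rightarrow> ('m + 'n, 's) scheme \<Rightarrow>
    nat \<Rightarrow> (('m + 'n) \<Rightarrow> 's) list \<Rightarrow> (real ^ ('m + 'n)) set" where
  "cell P \<mu> S k q = {state P \<mu> S y0 k | y0. y0 \<in> region S \<and> symbols P \<mu> S y0 k = q}"

text \<open>In \<open>real ^ 'k\<close> the predicate \<^const>\<open>is_interval\<close> describes exactly the products of (open,
  closed or half-open) intervals, that is, the axis-parallel boxes.\<close>

definition quantization_scheme ::
    "('m::finite, 'n::finite) qnum \<Rightarrow> real \<Rightarrow> ('m + 'n, 's) scheme \<Rightarrow> bool" where
  "quantization_scheme P \<mu> S \<longleftrightarrow>
     bounded (region S) \<and>
     (\<forall>r k. finite (alphabet S r k)) \<and>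
     (\<forall>r k vs ss. length vs = Suc k \<longrightarrow> length ss = k \<longrightarrow> enc S r vs ss \<in> alphabet S r k) \<and>
     (\<forall>k q. is_interval (cell P \<mu> S k q)) \<and>
     (\<forall>k q. cell P \<mu> S k q \<noteq> {} \<longrightarrow> qvalue S q \<in> cell P \<mu> S k q)"

definition zoom_in ::
    "('m::finite, 'n::finite) qnum \<Rightarrow> real \<Rightarrow> ('m + 'n, 's) scheme \<Rightarrow> bool" where
  "zoom_in P \<mu> S \<longleftrightarrow>
     (\<forall>k q. cell P \<mu> S k q \<noteq> {} \<longrightarrow>
        (\<Union>s. cell P \<mu> S (Suc k) (q @ [s])) = (\<lambda>y. That P \<mu> S y q) ` cell P \<mu> S k q \<and>
        disjoint_family (\<lambda>s. cell P \<mu> S (Suc k) (q @ [s])))"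

definition side_length :: "(real ^ 'k) set \<Rightarrow> 'k \<Rightarrow> real" where
  "side_length C r = Sup ((\<lambda>y. y $ r) ` C) - Inf ((\<lambda>y. y $ r) ` C)"

text \<open>A side of length 0 is not a quantization step. Such sides are unavoidable when a diagonal
  entry of the iteration matrix vanishes: the update then collapses the corresponding side of
  every cell to a point, which leaves nothing to quantize. If all cells are nondegenerate, the
  condition \<open>side_length C r > 0\<close> excludes nothing.\<close>

definition steps ::
    "('m::finite, 'n::finite) qnum \<Rightarrow> real \<Rightarrow> ('m + 'n, 's) scheme \<Rightarrow> nat \<Rightarrow> real set" where
  "steps P \<mu> S k = {side_length C r | C r.
     (\<exists>q. C = cell P \<mu> S k q) \<and> C \<noteq> {} \<and> side_length C r > 0}"

definition delta_max ::
    "('m::finite, 'n::finite) qnum \<Rightarrow> real \<Rightarrow> ('m + 'n, 's) scheme \<Rightarrow> nat \<Rightarrow> real" where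
  "delta_max P \<mu> S k = Max (steps P \<mu> S k)"

definition delta_min ::
    "('m::finite, 'n::finite) qnum \<Rightarrow> real \<Rightarrow> ('m + 'n, 's) scheme \<Rightarrow> nat \<Rightarrow> real" where
  "delta_min P \<mu> S k = Min (steps P \<mu> S k)"


section \<open>Random initial vectors and mean squared error\<close>

definition admissible_density :: "(real ^ 'k \<Rightarrow> real) \<Rightarrow> bool" where
  "admissible_density f \<longleftrightarrow>
     (\<forall>x. 0 \<le> f x) \<and> (\<exists>B. \<forall>x. f x \<le> B) \<and> bounded {x. f x \<noteq> 0} \<and>
     integrable lborel (\<lambda>x. f x * ln (f x))"

definition mse :: "'w measure \<Rightarrow> ('w \<Rightarrow> real ^ 'k) \<Rightarrow> ennreal" where
  "mse M e = (\<integral>\<^sup>+ \<omega>. ennreal ((norm (e \<omega>))\<^sup>2) \<partial>M)"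

definition elog :: "ennreal \<Rightarrow> ereal" where
  "elog x = (if x = 0 then -\<infinity> else if x = top then \<infinity> else ereal (ln (enn2real x)))"

end

theory Submission
  imports Defs
begin

text \<open>
The quantized iteration can bring the state close to the optimum only by increasing its
probability density, and the density can increase only in a controlled way.

Write \<open>T\<close> for the iteration matrix, \<open>d\<close> for \<open>\<Prod>r. \<bar>T $ r $ r\<bar>\<close> and \<open>n\<close> for the number of variables. The
update sends the state \<open>y\<close> with quantized value \<open>Q\<close> to \<open>T Q + diag T (y - Q)\<close> plus a constant
(\<open>That_component\<close>). On the set of initial vectors with given symbols, the map from the initial vector
to the state at time \<open>k\<close> is therefore affine with Jacobian of absolute value \<open>d ^ k\<close> (\<open>state_diff\<close>).
The cells at time \<open>k\<close> are the images of these sets. Cells with different histories may overlap, and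
the density of the state at a point is at most the sum, over the cells that contain the point, of
the bound \<open>B\<close> on the initial density divided by \<open>d ^ k\<close> (\<open>emeasure_state_vimage_le\<close>).

The overlap grows at most by the factor \<open>\<beta> = beta T \<rho>\<close> per time step (\<open>card_fat_cells_containing_le\<close>).
This is where the lattice enters: the representatives of all cells whose image covers a given
point satisfy that \<open>T Q\<close> is confined to a small box, and rounding them inside their cells to a
lattice of half the minimal step leaves only \<open>\<beta>\<close> candidates, the images under \<open>T\<close> of integer vectors
that lie in \<^const>\<open>boxB\<close> (\<open>card_overlapping_images_le\<close>).

So the density at time \<open>k\<close> is at most \<open>B * (\<beta> / d) ^ k\<close>. A cube around the optimum whose volume is half
the reciprocal of this bound has probability at most 1/2. With the complementary probability
the error is at least half the side of the cube, which has order \<open>(d / \<beta>) powr (k / n)\<close>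
(\<open>mse_ge_of_cube_prob\<close>). Squaring, taking logarithms and dividing by \<open>k\<close> gives the rate
\<open>- (2 / n) * ln (\<beta> / d)\<close>.
\<close>


section \<open>Axis-parallel boxes\<close>

text \<open>This makes \<^const>\<open>is_interval\<close> usable as "product of intervals": a point of a box may be assembled
from coordinates that are found one at a time. The coordinates of \<open>x\<close> are swapped into a point of
\<open>C\<close> one after the other, and every intermediate point lies between two points of \<open>C\<close>.\<close>

lemma is_interval_coordinatewise:
  fixes C :: "(real ^ 'k) set"
  assumes C: "is_interval C" and x: "\<And>r. \<exists>y\<in>C. y $ r = x $ r"
  shows "x \<in> C"
proof -
  have "\<exists>z\<in>C. \<forall>r\<in>F. z $ r = x $ r" if "finite F" for F
    using that
  proof induction
    case empty
    then show ?case using x by auto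
  next
    case (insert r F)
    then obtain z where z: "z \<in> C" "\<forall>r\<in>F. z $ r = x $ r" by blast
    obtain y where y: "y \<in> C" "y $ r = x $ r" using x by blast
    define z' where "z' = (\<chi> i. if i = r then x $ r else z $ i)"
    have "z' \<in> C"
      using C[unfolded is_interval_cart] z(1) y(1)
    proof (elim ballE allE impE)
      show "\<forall>i. z $ i \<le> z' $ i \<and> z' $ i \<le> y $ i \<or> y $ i \<le> z' $ i \<and> z' $ i \<le> z $ i"
        using y(2) linear by (auto simp: z'_def)
    qed auto
    moreover have "\<forall>i\<in>insert r F. z' $ i = x $ i" using z(2) by (simp add: z'_def)
    ultimately show ?case by blast
  qed
  from this[of UNIV] show ?thesis by (auto simp: vec_eq_iff[symmetric])
qed

lemma is_interval_coordinate_image: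
  fixes C :: "(real ^ 'k) set"
  assumes "is_interval C"
  shows "is_interval ((\<lambda>y. y $ r) ` C)"
  using convex_linear_image[OF bounded_linear.linear[OF bounded_linear_vec_nth] is_interval_convex[OF assms]]
  by (simp add: is_interval_convex_1)

text \<open>Cells are given only as order-convex sets, so their measurability has to come from this
representation as a finite intersection of preimages of real intervals.\<close>

lemma is_interval_borel:
  fixes C :: "(real ^ 'k) set"
  assumes "is_interval C"
  shows "C \<in> sets borel"
proof -
  let ?I = "\<lambda>r. (\<lambda>y. y $ r) ` C"
  have I: "?I r \<in> sets borel" for r
    using is_interval_coordinate_image[OF assms, of r]
    by (simp add: real_interval_borel_measurable)
  have "C = (\<Inter>r. (\<lambda>y. y $ r) -` ?I r)"
  proof (intro equalityI subsetI INT_I)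
    fix x assume "x \<in> (\<Inter>r. (\<lambda>y. y $ r) -` ?I r)"
    then have x: "x $ r \<in> ?I r" for r by blast
    have "\<exists>y\<in>C. y $ r = x $ r" for r
      using x[of r] by (elim imageE bexI[rotated]) (rule sym)
    then show "x \<in> C" by (rule is_interval_coordinatewise[OF assms])
  qed simp
  also have "\<dots> \<in> sets borel"
    by (intro sets.countable_INT'' measurable_sets_borel[OF _ I] borel_measurable_continuous_onI)
       (auto intro: continuous_intros)
  finally show ?thesis .
qed

text \<open>This is the form in which
nondegeneracy is inherited from an affine image by its source.\<close>

lemma side_length_pos_iff:
  fixes C :: "(real ^ 'k) set"
  assumes "bounded C" "C \<noteq> {}"
  shows "0 < side_length C r \<longleftrightarrow> (\<exists>x\<in>C. \<exists>y\<in>C. x $ r \<noteq> y $ r)"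
proof -
  let ?I = "(\<lambda>y. y $ r) ` C"
  have b: "bounded ?I"
    by (rule bounded_linear_image[OF assms(1) bounded_linear_vec_nth])
  note ab = bounded_imp_bdd_above[OF b] bounded_imp_bdd_below[OF b]
  show ?thesis
  proof
    assume "\<exists>x\<in>C. \<exists>y\<in>C. x $ r \<noteq> y $ r"
    then obtain x y where "x \<in> C" "y \<in> C" "x $ r < y $ r" by (metis linorder_neqE)
    then have "Inf ?I \<le> x $ r" "y $ r \<le> Sup ?I" "x $ r < y $ r"
      using ab by (auto intro!: cINF_lower cSUP_upper)
    then show "0 < side_length C r" by (simp add: side_length_def)
  next
    assume pos: "0 < side_length C r"
    show "\<exists>x\<in>C. \<exists>y\<in>C. x $ r \<noteq> y $ r"
    proof (rule ccontr)
      assume c: "\<not> ?thesis"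
      obtain a where "a \<in> C" using assms(2) by auto
      then have "\<forall>x\<in>C. x $ r = a $ r" using c by blast
      then have "?I = {a $ r}" using image_constant_conv[of "a $ r" C] assms(2) by (simp cong: image_cong_simp)
      then show False using pos by (simp add: side_length_def)
    qed
  qed
qed

lemma emeasure_flat_box:
  fixes C :: "(real ^ 'k) set"
  assumes "is_interval C" "bounded C" "\<not> 0 < side_length C r"
  shows "emeasure lborel C = 0"
proof (cases "C = {}")
  case False
  then obtain a where a: "a \<in> C" by auto
  have "C \<subseteq> {x. x $ r = a $ r}"
    using side_length_pos_iff[OF assms(2) False, of r] assms(3) a by blast
  moreover have "negligible {x::real^'k. x $ r = a $ r}"
    using negligible_standard_hyperplane[of "axis r 1 :: real^'k" "a $ r"]
    by (simp add: cart_eq_inner_axis)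
  ultimately have "negligible C" by (rule negligible_subset[rotated])
  then have "C \<in> null_sets (completion lborel)"
    by (simp only: negligible_iff_null_sets)
  then have "C \<in> null_sets lborel"
    using null_sets_completion_iff[of C lborel] is_interval_borel[OF assms(1)] by simp
  then show ?thesis by (rule null_setsD1)
qed simp

text \<open>Half of a box of side at least \<open>2 * \<eta>\<close>, seen from \<open>Q\<close>, still has length \<open>\<eta>\<close> in each coordinate, and
a half-open interval of length \<open>\<eta>\<close> contains a point of every translate of \<open>\<eta> \<int>\<close>. The factor 2 is
what makes the argument independent of whether the sides are open or closed and of the position
of \<open>Q\<close> in the box.\<close>

lemma lattice_point_near:
  fixes C :: "(real ^ 'k) set"
  assumes C: "is_interval C" "bounded C" and Q: "Q \<in> C"
    and \<eta>: "0 < \<eta>" and wide: "\<And>r. 2 * \<eta> \<le> side_length C r"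
  shows "\<exists>v. (\<forall>r. v $ r \<in> \<int>) \<and> w + \<eta> *\<^sub>R v \<in> C \<and> (\<forall>r. \<bar>(w + \<eta> *\<^sub>R v) $ r - Q $ r\<bar> \<le> \<eta>)"
proof -
  have "\<exists>i::int. \<bar>w $ r + \<eta> * i - Q $ r\<bar> \<le> \<eta> \<and> (\<exists>y\<in>C. y $ r = w $ r + \<eta> * i)" for r
  proof -
    let ?I = "(\<lambda>y. y $ r) ` C"
    define t where "t = (Q $ r - w $ r) / \<eta>"
    have t: "\<eta> * t = Q $ r - w $ r" using \<eta> by (simp add: t_def)
    have int: "is_interval ?I" by (rule is_interval_coordinate_image[OF C(1)])
    have b: "bounded ?I" by (rule bounded_linear_image[OF C(2) bounded_linear_vec_nth])
    note ab = bounded_imp_bdd_above[OF b] bounded_imp_bdd_below[OF b]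
    have QI: "Q $ r \<in> ?I" using Q by auto
    consider "\<eta> \<le> Sup ?I - Q $ r" | "\<eta> \<le> Q $ r - Inf ?I"
      using wide[of r] by (fastforce simp: side_length_def)
    then show ?thesis
    proof cases
      case 1
      \<comment> \<open>\<open>t\<close> is the position of \<open>Q $ r\<close> in the translated lattice, so rounding up moves towards \<open>Sup\<close>.\<close>
      have le: "\<eta> * t \<le> \<eta> * \<lceil>t\<rceil>" "\<eta> * \<lceil>t\<rceil> < \<eta> * (t + 1)" using \<eta>
        by (simp, simp only: mult_less_cancel_left_pos) linarith
      then have "w $ r + \<eta> * \<lceil>t\<rceil> < Sup ?I" "Q $ r \<le> w $ r + \<eta> * \<lceil>t\<rceil>"
        using 1 t by (auto simp: distrib_left)
      then obtain s where "s \<in> ?I" "w $ r + \<eta> * \<lceil>t\<rceil> < s"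
        using less_cSup_iff[OF _ ab(1)] QI by blast
      then have "w $ r + \<eta> * \<lceil>t\<rceil> \<in> ?I"
        using int[unfolded is_interval_1, rule_format, OF QI] \<open>Q $ r \<le> _\<close> by (metis less_imp_le)
      then show ?thesis using le t
        by (intro exI[of _ "\<lceil>t\<rceil>"]) (auto simp: distrib_left)
    next
      case 2
      have le: "\<eta> * \<lfloor>t\<rfloor> \<le> \<eta> * t" "\<eta> * (t - 1) < \<eta> * \<lfloor>t\<rfloor>" using \<eta>
        by (simp, simp only: mult_less_cancel_left_pos) linarith
      then have "Inf ?I < w $ r + \<eta> * \<lfloor>t\<rfloor>" "w $ r + \<eta> * \<lfloor>t\<rfloor> \<le> Q $ r"
        using 2 t by (auto simp: right_diff_distrib)
      then obtain s where "s \<in> ?I" "s < w $ r + \<eta> * \<lfloor>t\<rfloor>"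
        using cInf_less_iff[OF _ ab(2)] QI by blast
      then have "w $ r + \<eta> * \<lfloor>t\<rfloor> \<in> ?I"
        using int[unfolded is_interval_1, rule_format, OF _ QI] \<open>_ \<le> Q $ r\<close> by (metis less_imp_le)
      then show ?thesis using le t
        by (intro exI[of _ "\<lfloor>t\<rfloor>"]) (auto simp: right_diff_distrib)
    qed
  qed
  then obtain i :: "'k \<Rightarrow> int" where
    i: "\<And>r. \<bar>w $ r + \<eta> * i r - Q $ r\<bar> \<le> \<eta>" "\<And>r. \<exists>y\<in>C. y $ r = w $ r + \<eta> * i r" by metis
  show ?thesis
    using i by (intro exI[of _ "\<chi> r. of_int (i r)"] conjI allI is_interval_coordinatewise[OF C(1)]) auto
qed


section \<open>Overlap of affine images of boxes\<close>

lemma norm_inf_bound: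
  fixes A :: "real ^ 'k ^ 'k"
  assumes "\<And>s. \<bar>u $ s\<bar> \<le> 1"
  shows "\<bar>(A *v u) $ r\<bar> \<le> norm_inf A"
proof -
  have "\<bar>(A *v u) $ r\<bar> \<le> (\<Sum>s\<in>UNIV. \<bar>A $ r $ s * u $ s\<bar>)"
    unfolding matrix_vector_mult_def by simp
  also have "\<dots> \<le> (\<Sum>s\<in>UNIV. \<bar>A $ r $ s\<bar>)"
    using assms by (intro sum_mono) (simp add: abs_mult mult_left_le)
  also have "\<dots> \<le> norm_inf A" unfolding norm_inf_def by (intro Max_ge) auto
  finally show ?thesis .
qed

text \<open>An infinite set would have cardinality 0, and \<^const>\<open>beta\<close> could not serve as an upper bound. Since the
inverse of \<open>A\<close> sends the box to a bounded set, only finitely many integer vectors are involved.\<close>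

lemma finite_boxB_image_lattice:
  fixes A :: "real ^ 'k ^ 'k"
  assumes "invertible A"
  shows "finite (boxB A \<rho> \<inter> image_lattice A)"
proof -
  obtain B where B: "B ** A = mat 1" using assms by (auto simp: invertible_def)
  have BA: "B *v (A *v v) = v" for v by (simp add: B matrix_vector_mul_assoc)
  let ?c = "\<lambda>r. (4 * \<rho> * \<bar>A $ r $ r\<bar> + 2 * norm_inf A) / 2"
  have "boxB A \<rho> \<subseteq> cbox (\<chi> r. - ?c r) (\<chi> r. ?c r)"
  proof
    fix u assume u: "u \<in> boxB A \<rho>"
    have "- ?c r \<le> u $ r \<and> u $ r \<le> ?c r" for r
      using u unfolding boxB_def mem_Collect_eq by (metis abs_le_iff minus_le_iff)
    then show "u \<in> cbox (\<chi> r. - ?c r) (\<chi> r. ?c r)" by (simp add: mem_box_cart)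
  qed
  then have "bounded (boxB A \<rho>)" using bounded_cbox bounded_subset by blast
  then have "bounded ((*v) B ` boxB A \<rho>)"
    using bounded_linear_image matrix_vector_mul_bounded_linear by blast
  then obtain K where K: "\<And>v. v \<in> boxB A \<rho> \<Longrightarrow> norm (B *v v) \<le> K"
    unfolding bounded_iff by blast
  have "boxB A \<rho> \<inter> image_lattice A \<subseteq> (*v) A ` {v. \<forall>r. v $ r \<in> {x\<in>\<int>. \<bar>x\<bar> \<le> K}}"
  proof
    fix u assume u: "u \<in> boxB A \<rho> \<inter> image_lattice A"
    then obtain v where v: "u = A *v v" "\<forall>r. v $ r \<in> \<int>" by (auto simp: image_lattice_def)
    have "norm v \<le> K" using K[of u] u BA[of v] by (simp add: v)
    then have "\<bar>v $ r\<bar> \<le> K" for r using component_le_norm_cart[of v r] by linarith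
    then show "u \<in> (*v) A ` {v. \<forall>r. v $ r \<in> {x\<in>\<int>. \<bar>x\<bar> \<le> K}}" using v by auto
  qed
  moreover have "finite {x::real \<in> \<int>. \<bar>x\<bar> \<le> K}"
    by (rule finite_abs_int_segment)
  then have "finite (vec_lambda ` (UNIV \<rightarrow>\<^sub>E {x::real \<in> \<int>. \<bar>x\<bar> \<le> K}) :: (real^'k) set)"
    by (intro finite_imageI finite_PiE) auto
  then have "finite {v::real^'k. \<forall>r. v $ r \<in> {x\<in>\<int>. \<bar>x\<bar> \<le> K}}"
    by (rule rev_finite_subset) (auto simp: image_iff PiE_def Pi_def intro!: bexI[of _ "vec_nth x" for x] exI[of _ "vec_nth x" for x])
  ultimately show ?thesis by (meson finite_imageI finite_subset)
qed

text \<open>The counting step. Every cell \<open>C j\<close> is moved by the affine map with linear part \<open>diag T\<close> that sends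
its representative \<open>Q j\<close> to \<open>T *v Q j + c\<close>; the question is how many of the images can cover one
point \<open>z\<close>. Let \<open>w\<close> be the point with \<open>T *v w + c = z\<close>. If \<open>y \<in> C j\<close> is sent to \<open>z\<close>, then
\<open>T (Q j - w) = - diag T (y - Q j)\<close>, which is at most \<open>b * \<bar>T $ r $ r\<bar>\<close> in coordinate \<open>r\<close>. Replace
\<open>Q j\<close> by a point \<open>w + \<eta> I j\<close> of \<open>C j\<close> in the lattice of mesh \<open>\<eta> = a / 2\<close> centred at \<open>w\<close>, at
distance at most \<open>\<eta>\<close> in each coordinate. After division by \<open>\<eta>\<close>, \<open>T *v I j\<close> lies in \<^const>\<open>boxB\<close>. So
there are at most \<^const>\<open>beta\<close> possible values of \<open>I j\<close>, and cells with the same value all contain the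
same point, so that there are at most \<open>m\<close> of them.

Centring the lattice at \<open>w\<close>, and not at the origin, is what allows a box around the origin to be
used: no differences of lattice points have to be taken.\<close>

lemma card_overlapping_images_le:
  fixes T :: "real ^ 'k ^ 'k"
  assumes inv: "invertible T" and fin: "finite J"
    and box: "\<And>j. j \<in> J \<Longrightarrow> is_interval (C j)" "\<And>j. j \<in> J \<Longrightarrow> bounded (C j)"
    and rep: "\<And>j. j \<in> J \<Longrightarrow> Q j \<in> C j"
    and a: "0 < a"
    and side: "\<And>j r. j \<in> J \<Longrightarrow> a \<le> side_length (C j) r" "\<And>j r. j \<in> J \<Longrightarrow> side_length (C j) r \<le> b"
    and overlap: "\<And>x. card {j\<in>J. x \<in> C j} \<le> m"
  shows "card {j\<in>J. \<exists>y\<in>C j. \<forall>r. z $ r = (T *v Q j) $ r + T $ r $ r * (y $ r - Q j $ r) + c $ r}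
           \<le> beta T (b / a) * m"
    (is "card ?J \<le> _")
proof -
  obtain B where B: "T ** B = mat 1" "B ** T = mat 1" using inv by (auto simp: invertible_def)
  define w where "w = B *v (z - c)"
  have Tw: "T *v w = z - c" by (simp add: w_def B matrix_vector_mul_assoc)
  define \<eta> where "\<eta> = a / 2"
  have \<eta>: "0 < \<eta>" using a by (simp add: \<eta>_def)
  have "\<exists>v. (\<forall>r. v $ r \<in> \<int>) \<and> w + \<eta> *\<^sub>R v \<in> C j \<and> (\<forall>r. \<bar>(w + \<eta> *\<^sub>R v) $ r - Q j $ r\<bar> \<le> \<eta>)"
    if "j \<in> J" for j
    by (rule lattice_point_near) (use that box rep \<eta> side(1) in \<open>auto simp: \<eta>_def\<close>)
  then obtain I where I: "\<And>j r. j \<in> J \<Longrightarrow> I j $ r \<in> \<int>" "\<And>j. j \<in> J \<Longrightarrow> w + \<eta> *\<^sub>R I j \<in> C j"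
      "\<And>j r. j \<in> J \<Longrightarrow> \<bar>(w + \<eta> *\<^sub>R I j) $ r - Q j $ r\<bar> \<le> \<eta>" by metis
  have inB: "T *v I j \<in> boxB T (b / a) \<inter> image_lattice T" if j: "j \<in> ?J" for j
  proof -
    obtain y where y: "y \<in> C j" and z: "\<And>r. z $ r = (T *v Q j) $ r + T $ r $ r * (y $ r - Q j $ r) + c $ r"
      using j by auto
    have jJ: "j \<in> J" using j by simp
    \<comment> \<open>the rounding error in units of the mesh\<close>
    define u where "u = (1 / \<eta>) *\<^sub>R (w + \<eta> *\<^sub>R I j - Q j)"
    have u: "\<bar>u $ s\<bar> \<le> 1" for s
    proof -
      have "u $ s = ((w + \<eta> *\<^sub>R I j) $ s - Q j $ s) / \<eta>" by (simp add: u_def)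
      then show ?thesis using I(3)[OF jJ, of s] \<eta> by (simp del: vector_add_component)
    qed
    have Iu: "I j = u + (1 / \<eta>) *\<^sub>R (Q j - w)" using \<eta>
      by (simp add: u_def vec_eq_iff field_simps)
    have "(T *v Q j) $ r - (T *v w) $ r = - (T $ r $ r * (y $ r - Q j $ r))" for r
      using z[of r] by (simp add: Tw)
    then have T: "(T *v I j) $ r = (T *v u) $ r - T $ r $ r * (y $ r - Q j $ r) / \<eta>" for r
      by (simp add: Iu matrix_vector_right_distrib matrix_vector_mult_diff_distrib
          matrix_vector_mult_scaleR)
    have b: "\<bar>y $ r - Q j $ r\<bar> \<le> b" for r
    proof -
      have "bounded ((\<lambda>y. y $ r) ` C j)"
        by (rule bounded_linear_image[OF box(2)[OF jJ] bounded_linear_vec_nth])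
      note ab = bounded_imp_bdd_above[OF this] bounded_imp_bdd_below[OF this]
      have "x $ r \<le> Sup ((\<lambda>y. y $ r) ` C j)" "Inf ((\<lambda>y. y $ r) ` C j) \<le> x $ r" if "x \<in> C j" for x
        using ab that by (auto intro!: cINF_lower cSUP_upper)
      from this[OF y] this[OF rep[OF jJ]] show ?thesis
        using side(2)[OF jJ, of r] by (simp add: side_length_def)
    qed
    have "\<bar>(T *v I j) $ r\<bar> \<le> (4 * (b / a) * \<bar>T $ r $ r\<bar> + 2 * norm_inf T) / 2" for r
    proof -
      have "\<bar>(T *v I j) $ r\<bar> \<le> \<bar>(T *v u) $ r\<bar> + \<bar>T $ r $ r * (y $ r - Q j $ r) / \<eta>\<bar>"
        unfolding T by (rule abs_triangle_ineq4)
      also have "\<dots> \<le> norm_inf T + \<bar>T $ r $ r\<bar> * b / \<eta>"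
        using b[of r] \<eta> by (intro add_mono norm_inf_bound u) (simp add: abs_mult divide_right_mono mult_left_mono)
      also have "\<dots> = (4 * (b / a) * \<bar>T $ r $ r\<bar> + 2 * norm_inf T) / 2"
        using a by (simp add: \<eta>_def field_simps)
      finally show ?thesis .
    qed
    then show ?thesis using I(1)[OF jJ] by (auto simp: boxB_def image_lattice_def)
  qed
  have fib: "card {j \<in> ?J. T *v I j = v} \<le> m" for v
  proof (cases "\<exists>i\<in>?J. T *v I i = v")
    case True
    then obtain i where i: "i \<in> J" "T *v I i = v" by auto
    have "B *v (T *v x) = x" for x by (simp add: B matrix_vector_mul_assoc)
    then have "I j = I i" if "T *v I j = v" for j using that i(2) by metis
    then have "{j \<in> ?J. T *v I j = v} \<subseteq> {j\<in>J. w + \<eta> *\<^sub>R I i \<in> C j}" using I(2) by fastforce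
    then have "card {j \<in> ?J. T *v I j = v} \<le> card {j\<in>J. w + \<eta> *\<^sub>R I i \<in> C j}"
      using fin by (intro card_mono) auto
    then show ?thesis using overlap le_trans by blast
  next
    case False
    then have "{j \<in> ?J. T *v I j = v} = {}" by blast
    then show ?thesis by (metis card.empty zero_le)
  qed
  let ?L = "boxB T (b / a) \<inter> image_lattice T"
  have "?J = (\<Union>v\<in>?L. {j \<in> ?J. T *v I j = v})" using inB by blast
  then have "card ?J = card (\<Union>v\<in>?L. {j \<in> ?J. T *v I j = v})" by (rule arg_cong)
  also have "\<dots> \<le> (\<Sum>v\<in>?L. card {j \<in> ?J. T *v I j = v})"
    by (rule card_UN_le[OF finite_boxB_image_lattice[OF inv]])
  also have "\<dots> \<le> (\<Sum>v\<in>?L. m)" by (intro sum_mono fib)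
  finally show ?thesis by (simp add: beta_def)
qed


section \<open>Cells of the quantized iteration\<close>

lemma length_history:
  "length (fst (history P \<mu> S y k)) = Suc k" "length (snd (history P \<mu> S y k)) = Suc k"
  by (induction k) (auto simp: Let_def split: prod.splits)

lemma length_symbols [simp]: "length (symbols P \<mu> S y k) = Suc k"
  by (simp add: symbols_def length_history)

lemma state_0 [simp]: "state P \<mu> S y 0 = y"
  by (simp add: state_def)

lemma symbols_0: "symbols P \<mu> S y 0 = [encode S [y] []]"
  by (simp add: symbols_def)

lemma state_Suc: "state P \<mu> S y (Suc k) = That P \<mu> S (state P \<mu> S y k) (symbols P \<mu> S y k)"
  by (simp add: state_def symbols_def Let_def split: prod.split)

lemma symbols_Suc: "\<exists>s. symbols P \<mu> S y (Suc k) = symbols P \<mu> S y k @ [s]"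
  by (simp add: symbols_def Let_def split: prod.split)

text \<open>The part of the update that does not depend on the state or on the symbols.\<close>

definition drift :: "('m::finite, 'n::finite) qnum \<Rightarrow> real \<Rightarrow> real ^ ('m + 'n)" where
  "drift P \<mu> = join (\<mu> *\<^sub>R qc P) (- \<mu> *\<^sub>R qb P)"

text \<open>The state itself enters the update only through the diagonal of the iteration matrix; the full
matrix acts on the quantized values. For \<open>y = qvalue S q\<close> this is the unquantized iteration.\<close>

lemma That_component:
  fixes P :: "('m::finite, 'n::finite) qnum" and S :: "('m + 'n, 's) scheme"
  shows "That P \<mu> S y q $ r = (pd_matrix P \<mu> *v qvalue S q) $ r
           + pd_matrix P \<mu> $ r $ r * (y $ r - qvalue S q $ r) + drift P \<mu> $ r"
proof -
  have split: "(\<Sum>s\<in>UNIV. g s) = (\<Sum>i\<in>UNIV. g (Inl i)) + (\<Sum>j\<in>UNIV. g (Inr j))" for g :: "'m + 'n \<Rightarrow> real"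
    by (subst UNIV_Plus_UNIV[symmetric], subst sum.Plus) (auto simp: comp_def)
  show ?thesis
  proof (cases r)
    case (Inl i)
    have "(\<Sum>i'\<in>UNIV. (if i = i' then 1 - \<mu> * qa P $ i else 0) * qvalue S q $ Inl i')
          = (\<Sum>i'\<in>UNIV. if i = i' then (1 - \<mu> * qa P $ i) * qvalue S q $ Inl i' else 0)"
      by (rule sum.cong) auto
    also have "\<dots> = (1 - \<mu> * qa P $ i) * qvalue S q $ Inl i"
      by (subst sum.delta') auto
    finally have "(\<Sum>i'\<in>UNIV. (if i = i' then 1 - \<mu> * qa P $ i else 0) * qvalue S q $ Inl i')
          = (1 - \<mu> * qa P $ i) * qvalue S q $ Inl i" .
    then show ?thesis
      unfolding Inl That_def pd_matrix_def matrix_vector_mult_def drift_def join_def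
      by (simp add: split sum_negf sum_distrib_left algebra_simps)
  next
    case (Inr j)
    have "(\<Sum>j'\<in>UNIV. (if j = j' then 1 else 0) * qvalue S q $ Inr j')
          = (\<Sum>j'\<in>UNIV. if j = j' then qvalue S q $ Inr j' else 0)"
      by (rule sum.cong) auto
    also have "\<dots> = qvalue S q $ Inr j"
      by (subst sum.delta') auto
    finally have "(\<Sum>j'\<in>UNIV. (if j = j' then 1 else 0) * qvalue S q $ Inr j') = qvalue S q $ Inr j" .
    then show ?thesis
      unfolding Inr That_def pd_matrix_def matrix_vector_mult_def drift_def join_def
      by (simp add: split sum_distrib_left algebra_simps)
  qed
qed

text \<open>Two runs with the same symbols use the same quantized values, which cancel in the difference. On
the set of initial vectors with given symbols, the state is therefore an affine function of the
initial vector whose linear part is a power of \<open>diag T\<close>.\<close>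

lemma state_diff:
  assumes "symbols P \<mu> S x k = symbols P \<mu> S y k"
  shows "state P \<mu> S x k $ r - state P \<mu> S y k $ r = pd_matrix P \<mu> $ r $ r ^ k * (x $ r - y $ r)"
  using assms
proof (induction k)
  case (Suc k)
  then have eq: "symbols P \<mu> S x k = symbols P \<mu> S y k"
    using symbols_Suc[of P \<mu> S x k] symbols_Suc[of P \<mu> S y k] by (metis butlast_snoc)
  have "state P \<mu> S x (Suc k) $ r - state P \<mu> S y (Suc k) $ r
        = pd_matrix P \<mu> $ r $ r * (state P \<mu> S x k $ r - state P \<mu> S y k $ r)"
    by (simp add: state_Suc That_component eq algebra_simps)
  then show ?case using Suc.IH[OF eq] by simp
qed simp

lemma finite_range_symbols:
  fixes P :: "('m::finite, 'n::finite) qnum" and S :: "('m + 'n, 's) scheme"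
  assumes "quantization_scheme P \<mu> S"
  shows "finite (range (\<lambda>y. symbols P \<mu> S y k))"
proof -
  let ?A = "\<lambda>k. {s. \<forall>r. s r \<in> alphabet S r k}"
  have fin: "finite (?A k)" for k
  proof -
    have "finite (\<Pi>\<^sub>E r\<in>(UNIV :: ('m + 'n) set). alphabet S r k)"
      using assms by (intro finite_PiE) (auto simp: quantization_scheme_def)
    then show ?thesis by (simp add: PiE_def Pi_def)
  qed
  have enc: "encode S ys q \<in> ?A k" if "length ys = Suc k" "length q = k" for ys q k
    using assms that by (simp add: encode_def quantization_scheme_def)
  show ?thesis
  proof (induction k)
    case 0
    show ?case
      by (rule finite_subset[of _ "(\<lambda>s. [s]) ` ?A 0"]) (use enc[of _ 0] fin in \<open>auto simp: symbols_0\<close>)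
  next
    case (Suc k)
    have "symbols P \<mu> S y (Suc k) \<in> (\<lambda>(q, s). q @ [s]) ` (range (\<lambda>y. symbols P \<mu> S y k) \<times> ?A (Suc k))" for y
    proof -
      obtain ys q where h: "history P \<mu> S y k = (ys, q)" by fastforce
      have l: "length ys = Suc k" "length q = Suc k" using length_history[of P \<mu> S y k] by (simp_all add: h)
      have "encode S (ys @ [That P \<mu> S (last ys) q]) q \<in> ?A (Suc k)" by (rule enc) (simp_all add: l)
      moreover have "q \<in> range (\<lambda>y. symbols P \<mu> S y k)"
        by (rule range_eqI[of _ _ y]) (simp add: symbols_def h)
      ultimately show ?thesis
        by (auto simp: symbols_def h Let_def image_iff)
    qed
    then show ?case by (intro finite_subset[OF _ finite_imageI[OF finite_cartesian_product[OF Suc fin]]]) auto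
  qed
qed

lemma cell_memI: "y \<in> region S \<Longrightarrow> state P \<mu> S y k \<in> cell P \<mu> S k (symbols P \<mu> S y k)"
  by (auto simp: cell_def)

lemma finite_cells:
  assumes "quantization_scheme P \<mu> S"
  shows "finite {q. cell P \<mu> S k q \<noteq> {}}"
  by (rule finite_subset[OF _ finite_range_symbols[OF assms, of k]]) (auto simp: cell_def)

lemma bounded_cell:
  assumes "quantization_scheme P \<mu> S"
  shows "bounded (cell P \<mu> S k q)"
proof (cases "cell P \<mu> S k q = {}")
  case False
  then obtain z where z: "z \<in> region S" "symbols P \<mu> S z k = q" by (auto simp: cell_def)
  obtain K where K: "\<And>y. y \<in> region S \<Longrightarrow> norm y \<le> K"
    using assms by (auto simp: quantization_scheme_def bounded_iff)
  let ?d = "\<lambda>r. \<bar>pd_matrix P \<mu> $ r $ r ^ k\<bar> * (2 * K)"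
  have "cell P \<mu> S k q \<subseteq> cbox (\<chi> r. state P \<mu> S z k $ r - ?d r) (\<chi> r. state P \<mu> S z k $ r + ?d r)"
  proof
    fix x assume "x \<in> cell P \<mu> S k q"
    then obtain y where y: "y \<in> region S" "symbols P \<mu> S y k = q" "x = state P \<mu> S y k"
      by (auto simp: cell_def)
    have "\<bar>x $ r - state P \<mu> S z k $ r\<bar> \<le> ?d r" for r
    proof -
      have "\<bar>y $ r - z $ r\<bar> \<le> 2 * K"
        using component_le_norm_cart[of y r] component_le_norm_cart[of z r] K[OF y(1)] K[OF z(1)] by linarith
      then show ?thesis using state_diff[of P \<mu> S y k z r] y z
        by (simp add: abs_mult mult_left_mono)
    qed
    then show "x \<in> cbox (\<chi> r. state P \<mu> S z k $ r - ?d r) (\<chi> r. state P \<mu> S z k $ r + ?d r)"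
      by (simp add: mem_box_cart abs_le_iff) (smt (verit))
  qed
  then show ?thesis using bounded_cbox bounded_subset by blast
qed simp

text \<open>Only cells of positive volume matter for a random vector with a density. For them all sides lie
between \<^const>\<open>delta_min\<close> and \<^const>\<open>delta_max\<close>, while a degenerate cell may have sides of length 0.\<close>

definition fat_cells ::
    "('m::finite, 'n::finite) qnum \<Rightarrow> real \<Rightarrow> ('m + 'n, 's) scheme \<Rightarrow> nat \<Rightarrow> (('m + 'n) \<Rightarrow> 's) list set" where
  "fat_cells P \<mu> S k = {q. cell P \<mu> S k q \<noteq> {} \<and> (\<forall>r. 0 < side_length (cell P \<mu> S k q) r)}"

lemma finite_fat_cells:
  "quantization_scheme P \<mu> S \<Longrightarrow> finite (fat_cells P \<mu> S k)"
  by (rule finite_subset[OF _ finite_cells]) (auto simp: fat_cells_def)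

lemma finite_steps:
  assumes "quantization_scheme P \<mu> S"
  shows "finite (steps P \<mu> S k)"
proof -
  have "steps P \<mu> S k \<subseteq> (\<lambda>(q, r). side_length (cell P \<mu> S k q) r) ` ({q. cell P \<mu> S k q \<noteq> {}} \<times> UNIV)"
    by (auto simp: steps_def)
  then show ?thesis
    by (rule finite_subset) (intro finite_imageI finite_cartesian_product finite_cells[OF assms] finite)
qed

lemma side_length_fat_cell:
  assumes "quantization_scheme P \<mu> S" "q \<in> fat_cells P \<mu> S k"
  shows "0 < delta_min P \<mu> S k"
    and "delta_min P \<mu> S k \<le> side_length (cell P \<mu> S k q) r"
    and "side_length (cell P \<mu> S k q) r \<le> delta_max P \<mu> S k"
proof -
  have mem: "side_length (cell P \<mu> S k q) r \<in> steps P \<mu> S k" for r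
    using assms(2) by (auto simp: steps_def fat_cells_def)
  show "delta_min P \<mu> S k \<le> side_length (cell P \<mu> S k q) r"
    "side_length (cell P \<mu> S k q) r \<le> delta_max P \<mu> S k"
    using mem finite_steps[OF assms(1)] by (simp_all add: delta_min_def delta_max_def)
  have "delta_min P \<mu> S k \<in> steps P \<mu> S k"
    unfolding delta_min_def using mem finite_steps[OF assms(1)] by (intro Min_in) auto
  then show "0 < delta_min P \<mu> S k" by (auto simp: steps_def)
qed

text \<open>Cells arise by subdividing images of earlier cells, and the image of a flat box is flat, so cells
of positive volume have ancestors of positive volume only.\<close>

lemma fat_cell_Suc:
  assumes Q: "quantization_scheme P \<mu> S" and q: "q \<in> fat_cells P \<mu> S (Suc k)"
  shows "butlast q \<in> fat_cells P \<mu> S k" "q = butlast q @ [last q]"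
    "cell P \<mu> S (Suc k) q \<subseteq> (\<lambda>y. That P \<mu> S y (butlast q)) ` cell P \<mu> S k (butlast q)"
proof -
  obtain z where z: "z \<in> region S" "symbols P \<mu> S z (Suc k) = q" using q by (auto simp: fat_cells_def cell_def)
  show "q = butlast q @ [last q]" using z(2) length_symbols[of P \<mu> S z "Suc k"]
    by (metis append_butlast_last_id list.size(3) nat.distinct(1))
  have bl: "butlast (symbols P \<mu> S y (Suc k)) = symbols P \<mu> S y k" for y
    using symbols_Suc[of P \<mu> S y k] by auto
  show sub: "cell P \<mu> S (Suc k) q \<subseteq> (\<lambda>y. That P \<mu> S y (butlast q)) ` cell P \<mu> S k (butlast q)"
  proof
    fix x assume "x \<in> cell P \<mu> S (Suc k) q"
    then obtain y where "y \<in> region S" "symbols P \<mu> S y (Suc k) = q" "x = state P \<mu> S y (Suc k)"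
      by (auto simp: cell_def)
    then show "x \<in> (\<lambda>y. That P \<mu> S y (butlast q)) ` cell P \<mu> S k (butlast q)"
      using cell_memI[of y S P \<mu> k] bl[of y] by (auto simp: state_Suc)
  qed
  have ne: "cell P \<mu> S k (butlast q) \<noteq> {}" using sub q by (auto simp: fat_cells_def)
  have "0 < side_length (cell P \<mu> S k (butlast q)) r" for r
  proof -
    have "0 < side_length (cell P \<mu> S (Suc k) q) r" "cell P \<mu> S (Suc k) q \<noteq> {}"
      using q by (auto simp: fat_cells_def)
    then obtain x x' where "x \<in> cell P \<mu> S (Suc k) q" "x' \<in> cell P \<mu> S (Suc k) q" "x $ r \<noteq> x' $ r"
      using side_length_pos_iff[OF bounded_cell[OF Q]] by metis
    then obtain y y' where "y \<in> cell P \<mu> S k (butlast q)" "y' \<in> cell P \<mu> S k (butlast q)"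
        "That P \<mu> S y (butlast q) $ r \<noteq> That P \<mu> S y' (butlast q) $ r"
      using sub by blast
    then show ?thesis unfolding side_length_pos_iff[OF bounded_cell[OF Q] ne]
      by (metis That_component)
  qed
  then show "butlast q \<in> fat_cells P \<mu> S k" using ne by (auto simp: fat_cells_def)
qed

text \<open>Cells that belong to different symbol histories may overlap from time 1 on, because only the
images of one and the same cell are partitioned. A point lies in at most one cell of each image,
hence in at most as many cells at time \<open>k + 1\<close> as there are images of cells at time \<open>k\<close> that cover it.
The counting step then bounds the growth of the overlap by the factor \<^const>\<open>beta\<close> per time step.\<close>

lemma card_fat_cells_containing_le:
  fixes P :: "('m::finite, 'n::finite) qnum"
  assumes Q: "quantization_scheme P \<mu> S" and zoom: "zoom_in P \<mu> S"
    and inv: "invertible (pd_matrix P \<mu>)"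
    and \<rho>: "\<And>k. \<rho> = delta_max P \<mu> S k / delta_min P \<mu> S k"
  shows "card {q \<in> fat_cells P \<mu> S k. x \<in> cell P \<mu> S k q} \<le> beta (pd_matrix P \<mu>) \<rho> ^ k"
proof (induction k arbitrary: x)
  case 0
  have "{q \<in> fat_cells P \<mu> S 0. x \<in> cell P \<mu> S 0 q} \<subseteq> {symbols P \<mu> S x 0}"
    by (auto simp: cell_def)
  then have "card {q \<in> fat_cells P \<mu> S 0. x \<in> cell P \<mu> S 0 q} \<le> card {symbols P \<mu> S x 0}"
    by (intro card_mono) auto
  then show ?case by simp
next
  case (Suc k)
  let ?T = "pd_matrix P \<mu>" and ?F = "fat_cells P \<mu> S k"
  let ?J = "{q \<in> ?F. \<exists>y\<in>cell P \<mu> S k q. \<forall>r. x $ r = (?T *v qvalue S q) $ r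
              + ?T $ r $ r * (y $ r - qvalue S q $ r) + drift P \<mu> $ r}"
  let ?N = "{q \<in> fat_cells P \<mu> S (Suc k). x \<in> cell P \<mu> S (Suc k) q}"
  have "inj_on butlast ?N"
  proof (rule inj_onI)
    fix q q' assume q: "q \<in> ?N" and q': "q' \<in> ?N" and eq: "butlast q = butlast q'"
    have "cell P \<mu> S k (butlast q) \<noteq> {}" using fat_cell_Suc(1)[OF Q, of q k] q by (auto simp: fat_cells_def)
    then have "disjoint_family (\<lambda>s. cell P \<mu> S (Suc k) (butlast q @ [s]))"
      using zoom by (simp add: zoom_in_def)
    moreover have "x \<in> cell P \<mu> S (Suc k) (butlast q @ [last q])" "x \<in> cell P \<mu> S (Suc k) (butlast q @ [last q'])"
      using q q' fat_cell_Suc(2)[OF Q, of _ k] eq by (metis (mono_tags, lifting) mem_Collect_eq)+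
    ultimately have "last q = last q'" by (auto simp: disjoint_family_on_def)
    then show "q = q'" using q q' eq fat_cell_Suc(2)[OF Q, of _ k] by (metis (mono_tags, lifting) mem_Collect_eq)
  qed
  moreover have "butlast ` ?N \<subseteq> ?J"
  proof
    fix p assume "p \<in> butlast ` ?N"
    then obtain q where q: "p = butlast q" "q \<in> fat_cells P \<mu> S (Suc k)" "x \<in> cell P \<mu> S (Suc k) q" by auto
    note f = fat_cell_Suc[OF Q q(2)]
    obtain y where "y \<in> cell P \<mu> S k p" "x = That P \<mu> S y p" using f(3) q by auto
    then show "p \<in> ?J" using f(1) q(1) by (auto simp: That_component)
  qed
  ultimately have "card ?N \<le> card ?J"
    by (rule card_inj_on_le) (use finite_fat_cells[OF Q] in auto)
  also have "\<dots> \<le> beta ?T \<rho> * beta ?T \<rho> ^ k"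
  proof (cases "?F = {}")
    case False
    show ?thesis
      unfolding \<rho>[of k]
    proof (rule card_overlapping_images_le[OF inv finite_fat_cells[OF Q]])
      fix q assume q: "q \<in> ?F"
      show "is_interval (cell P \<mu> S k q)" using Q by (simp add: quantization_scheme_def)
      show "bounded (cell P \<mu> S k q)" by (rule bounded_cell[OF Q])
      show "qvalue S q \<in> cell P \<mu> S k q" using Q q by (simp add: quantization_scheme_def fat_cells_def)
      show "delta_min P \<mu> S k \<le> side_length (cell P \<mu> S k q) r" for r by (rule side_length_fat_cell(2)[OF Q q])
      show "side_length (cell P \<mu> S k q) r \<le> delta_max P \<mu> S k" for r by (rule side_length_fat_cell(3)[OF Q q])
    next
      show "0 < delta_min P \<mu> S k" using side_length_fat_cell(1)[OF Q] False by blast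
    next
      show "card {j \<in> ?F. y \<in> cell P \<mu> S k j} \<le> beta ?T (delta_max P \<mu> S k / delta_min P \<mu> S k) ^ k" for y
        using Suc.IH unfolding \<rho>[of k] .
    qed
  qed (simp add: card_gt_0_iff)
  finally show ?case by simp
qed


section \<open>Growth of the density of the state\<close>

lemma prod_Basis_vec:
  "(\<Prod>b\<in>(Basis :: (real ^ 'k) set). f b) = (\<Prod>i\<in>UNIV. f (axis i 1))"
proof -
  have B: "(Basis :: (real ^ 'k) set) = range (\<lambda>i. axis i 1)"
    by (auto simp: Basis_vec_def)
  have inj: "inj (\<lambda>i. axis i 1 :: real ^ 'k)" by (auto simp: inj_def axis_eq_axis)
  show ?thesis unfolding B prod.reindex[OF inj] by (simp add: comp_def)
qed

text \<open>The change of variables for the maps that \<open>state_diff\<close> produces.\<close>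

lemma lborel_diagonal_affine:
  fixes t c :: "'k::finite \<Rightarrow> real"
  assumes c: "\<And>r. c r \<noteq> 0" and A: "A \<in> sets borel"
  defines "h \<equiv> \<lambda>x :: real ^ 'k. \<chi> r. t r + c r * x $ r"
  shows "h \<in> borel_measurable borel"
    and "emeasure lborel A = ennreal (\<Prod>r\<in>UNIV. \<bar>c r\<bar>) * emeasure lborel (h -` A)"
proof -
  show meas: "h \<in> borel_measurable borel"
    unfolding h_def by (intro borel_measurable_continuous_onI continuous_intros)
  let ?c = "\<lambda>j. vec_lambda c \<bullet> j"
  let ?h = "\<lambda>x. vec_lambda t + (\<Sum>j\<in>Basis. (?c j * (x \<bullet> j)) *\<^sub>R j)"
  have "?h x $ r = h x $ r" for x r
  proof -
    have "(\<Sum>j\<in>Basis. (?c j * (x \<bullet> j)) *\<^sub>R j) $ r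
      = (\<Sum>j\<in>Basis. (?c j * (x \<bullet> j)) *\<^sub>R j) \<bullet> axis r 1"
      by (simp add: cart_eq_inner_axis)
    also have "\<dots> = ?c (axis r 1) * (x \<bullet> axis r 1)"
      by (subst inner_sum_left_Basis) (auto simp: Basis_vec_def)
    finally show ?thesis by (simp add: h_def inner_axis)
  qed
  then have h: "?h = h" by (simp add: fun_eq_iff vec_eq_iff)
  have "lborel = density (distr lborel borel ?h) (\<lambda>_. ennreal (\<Prod>j\<in>Basis. \<bar>?c j\<bar>))"
    by (rule lborel_affine_euclidean) (use c in \<open>auto simp: Basis_vec_def inner_axis\<close>)
  then have "lborel = density (distr lborel borel h) (\<lambda>_. ennreal (\<Prod>r\<in>UNIV. \<bar>c r\<bar>))"
    unfolding h by (simp add: prod_Basis_vec inner_axis)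
  then have "emeasure lborel A = emeasure (density (distr lborel borel h) (\<lambda>_. ennreal (\<Prod>r\<in>UNIV. \<bar>c r\<bar>))) A"
    by (rule arg_cong)
  also have "\<dots> = ennreal (\<Prod>r\<in>UNIV. \<bar>c r\<bar>) * emeasure lborel (h -` A)"
    using A meas by (simp add: emeasure_density_const emeasure_distr)
  finally show "emeasure lborel A = ennreal (\<Prod>r\<in>UNIV. \<bar>c r\<bar>) * emeasure lborel (h -` A)" .
qed

text \<open>The sum of the volumes is the integral over \<open>E\<close> of the number of cells that contain a point; flat
cells contribute nothing to it.\<close>

lemma emeasure_fat_cells_le:
  fixes P :: "('m::finite, 'n::finite) qnum"
  assumes Q: "quantization_scheme P \<mu> S" and zoom: "zoom_in P \<mu> S"
    and inv: "invertible (pd_matrix P \<mu>)"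
    and \<rho>: "\<And>k. \<rho> = delta_max P \<mu> S k / delta_min P \<mu> S k"
    and E: "E \<in> sets borel"
  shows "(\<Sum>q\<in>{q. cell P \<mu> S k q \<noteq> {}}. emeasure lborel (E \<inter> cell P \<mu> S k q))
           \<le> of_nat (beta (pd_matrix P \<mu>) \<rho> ^ k) * emeasure lborel E"
proof -
  let ?F = "fat_cells P \<mu> S k"
  have int: "is_interval (cell P \<mu> S k q)" for q using Q by (simp add: quantization_scheme_def)
  have [measurable]: "cell P \<mu> S k q \<in> sets borel" for q by (rule is_interval_borel[OF int])
  note E[measurable]
  have fin: "finite ?F" by (rule finite_fat_cells[OF Q])
  have "emeasure lborel (E \<inter> cell P \<mu> S k q) = 0" if q: "cell P \<mu> S k q \<noteq> {}" "q \<notin> ?F" for q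
  proof -
    obtain r where "\<not> 0 < side_length (cell P \<mu> S k q) r" using q by (auto simp: fat_cells_def)
    then have "emeasure lborel (cell P \<mu> S k q) = 0"
      by (rule emeasure_flat_box[OF int bounded_cell[OF Q]])
    moreover have "emeasure lborel (E \<inter> cell P \<mu> S k q) \<le> emeasure lborel (cell P \<mu> S k q)"
      by (rule emeasure_mono) auto
    ultimately show ?thesis by simp
  qed
  then have "(\<Sum>q\<in>{q. cell P \<mu> S k q \<noteq> {}}. emeasure lborel (E \<inter> cell P \<mu> S k q))
      = (\<Sum>q\<in>?F. emeasure lborel (E \<inter> cell P \<mu> S k q))"
    using finite_cells[OF Q] by (intro sum.mono_neutral_right) (auto simp: fat_cells_def)
  also have "\<dots> = (\<Sum>q\<in>?F. \<integral>\<^sup>+x. indicator (E \<inter> cell P \<mu> S k q) x \<partial>lborel)" by simp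
  also have "\<dots> = (\<integral>\<^sup>+x. (\<Sum>q\<in>?F. indicator (E \<inter> cell P \<mu> S k q) x) \<partial>lborel)"
    by (rule nn_integral_sum[symmetric]) auto
  also have "\<dots> \<le> (\<integral>\<^sup>+x. of_nat (beta (pd_matrix P \<mu>) \<rho> ^ k) * indicator E x \<partial>lborel)"
  proof (rule nn_integral_mono)
    fix x
    have "(\<Sum>q\<in>?F. of_bool (x \<in> cell P \<mu> S k q) :: ennreal) = of_nat (card (?F \<inter> {q. x \<in> cell P \<mu> S k q}))"
      by (simp add: fin)
    then have "(\<Sum>q\<in>?F. indicator (E \<inter> cell P \<mu> S k q) x :: ennreal)
        = of_nat (card {q\<in>?F. x \<in> cell P \<mu> S k q}) * indicator E x"
      by (simp add: indicator_inter_arith sum_distrib_left[symmetric] indicator_def Int_def)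
    also have "\<dots> \<le> of_nat (beta (pd_matrix P \<mu>) \<rho> ^ k) * indicator E x"
      using card_fat_cells_containing_le[OF Q zoom inv \<rho>]
      by (intro mult_right_mono) (simp_all del: of_nat_power)
    finally show "(\<Sum>q\<in>?F. indicator (E \<inter> cell P \<mu> S k q) x :: ennreal)
        \<le> of_nat (beta (pd_matrix P \<mu>) \<rho> ^ k) * indicator E x" .
  qed
  also have "\<dots> = of_nat (beta (pd_matrix P \<mu>) \<rho> ^ k) * emeasure lborel E"
    by (subst nn_integral_cmult) auto
  finally show ?thesis .
qed

text \<open>Split the initial vectors according to their symbols up to time \<open>k\<close>. On each piece the state is an
affine function of the initial vector that multiplies volumes by \<open>(\<Prod>r. \<bar>T $ r $ r\<bar>) ^ k\<close>, and the
images of the pieces are the cells, which cover \<open>E\<close> at most \<open>beta T \<rho> ^ k\<close> times. In other words, the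
density of the state grows per time step at most by the factor \<open>beta T \<rho> / (\<Prod>r. \<bar>T $ r $ r\<bar>)\<close>.
The encoders may be arbitrary functions; the preimage is measurable because it is put together
from affine preimages of boxes.\<close>

lemma emeasure_state_vimage_le:
  fixes P :: "('m::finite, 'n::finite) qnum"
  assumes Q: "quantization_scheme P \<mu> S" and zoom: "zoom_in P \<mu> S"
    and inv: "invertible (pd_matrix P \<mu>)"
    and \<rho>: "\<And>k. \<rho> = delta_max P \<mu> S k / delta_min P \<mu> S k"
    and diag: "\<And>r. pd_matrix P \<mu> $ r $ r \<noteq> 0"
    and E: "E \<in> sets borel"
  shows "{y \<in> region S. state P \<mu> S y k \<in> E} \<in> sets borel"
    and "ennreal ((\<Prod>r\<in>UNIV. \<bar>pd_matrix P \<mu> $ r $ r\<bar>) ^ k) * emeasure lborel {y \<in> region S. state P \<mu> S y k \<in> E}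
           \<le> of_nat (beta (pd_matrix P \<mu>) \<rho> ^ k) * emeasure lborel E"
proof -
  let ?T = "pd_matrix P \<mu>" and ?K = "{q. cell P \<mu> S k q \<noteq> {}}"
  define G where "G q = {y \<in> region S. symbols P \<mu> S y k = q \<and> state P \<mu> S y k \<in> E}" for q
  have int: "is_interval (cell P \<mu> S k q)" for q using Q by (simp add: quantization_scheme_def)
  have EC: "E \<inter> cell P \<mu> S k q \<in> sets borel" for q using E is_interval_borel[OF int] by auto
  have G: "G q \<in> sets borel \<and> emeasure lborel (E \<inter> cell P \<mu> S k q)
             = ennreal ((\<Prod>r\<in>UNIV. \<bar>?T $ r $ r\<bar>) ^ k) * emeasure lborel (G q)" if q: "q \<in> ?K" for q
  proof -
    obtain z where z: "z \<in> region S" "symbols P \<mu> S z k = q" using q by (auto simp: cell_def)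
    let ?t = "\<lambda>r. state P \<mu> S z k $ r - ?T $ r $ r ^ k * z $ r" and ?c = "\<lambda>r. ?T $ r $ r ^ k"
    define h where "h = (\<lambda>x. \<chi> r. ?t r + ?c r * x $ r)"
    have h: "state P \<mu> S y k = h y" if "symbols P \<mu> S y k = q" for y
      using state_diff[of P \<mu> S y k z] that z(2) by (simp add: h_def vec_eq_iff algebra_simps)
    have inj: "y = y'" if "h y = h y'" for y y'
      using that diag by (simp add: h_def vec_eq_iff)
    have eq: "G q = h -` (E \<inter> cell P \<mu> S k q)"
    proof (intro equalityI subsetI)
      fix y assume "y \<in> G q"
      then have "y \<in> region S" "symbols P \<mu> S y k = q" "state P \<mu> S y k \<in> E" by (auto simp: G_def)
      then show "y \<in> h -` (E \<inter> cell P \<mu> S k q)" using h[of y] cell_memI[of y S P \<mu> k] by auto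
    next
      \<comment> \<open>Since \<open>h\<close> is injective, a point that \<open>h\<close> sends into the cell is the very run that produced it.\<close>
      fix y assume y: "y \<in> h -` (E \<inter> cell P \<mu> S k q)"
      then obtain y' where y': "y' \<in> region S" "symbols P \<mu> S y' k = q" "h y = state P \<mu> S y' k"
        by (auto simp: cell_def)
      have "y = y'" by (rule inj, rule trans[OF y'(3) h[OF y'(2)]])
      then show "y \<in> G q" using y y' by (simp add: G_def)
    qed
    have c: "?c r \<noteq> 0" for r using diag by simp
    note aff = lborel_diagonal_affine[of ?c "E \<inter> cell P \<mu> S k q" ?t, OF c EC, folded h_def]
    have "G q \<in> sets borel"
      unfolding eq by (rule measurable_sets_borel[OF aff(1) EC])
    moreover have "(\<Prod>r\<in>UNIV. \<bar>?c r\<bar>) = (\<Prod>r\<in>UNIV. \<bar>?T $ r $ r\<bar>) ^ k"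
      by (simp add: power_abs prod_power_distrib)
    ultimately show ?thesis using aff(2) by (simp only: eq)
  qed
  have U: "{y \<in> region S. state P \<mu> S y k \<in> E} = (\<Union>q\<in>?K. G q)"
    using cell_memI[of _ S P \<mu> k] by (auto simp: G_def)
  show "{y \<in> region S. state P \<mu> S y k \<in> E} \<in> sets borel"
    unfolding U using finite_cells[OF Q] G by (intro sets.finite_UN) auto
  have "emeasure lborel (\<Union>q\<in>?K. G q) \<le> (\<Sum>q\<in>?K. emeasure lborel (G q))"
    using finite_cells[OF Q] G by (intro emeasure_subadditive_finite) auto
  then have "ennreal ((\<Prod>r\<in>UNIV. \<bar>?T $ r $ r\<bar>) ^ k) * emeasure lborel (\<Union>q\<in>?K. G q)
      \<le> (\<Sum>q\<in>?K. ennreal ((\<Prod>r\<in>UNIV. \<bar>?T $ r $ r\<bar>) ^ k) * emeasure lborel (G q))"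
    unfolding sum_distrib_left[symmetric] by (rule mult_left_mono) simp
  also have "\<dots> = (\<Sum>q\<in>?K. emeasure lborel (E \<inter> cell P \<mu> S k q))"
    by (intro sum.cong) (use G in auto)
  also have "\<dots> \<le> of_nat (beta ?T \<rho> ^ k) * emeasure lborel E"
    by (rule emeasure_fat_cells_le[OF Q zoom inv \<rho> E])
  finally show "ennreal ((\<Prod>r\<in>UNIV. \<bar>?T $ r $ r\<bar>) ^ k) * emeasure lborel {y \<in> region S. state P \<mu> S y k \<in> E}
           \<le> of_nat (beta ?T \<rho> ^ k) * emeasure lborel E"
    unfolding U .
qed

lemma continuous_join: "continuous_on UNIV (\<lambda>(x, l). join x l)"
proof -
  have "continuous_on UNIV (\<lambda>p. case r of Inl i \<Rightarrow> fst p $ i | Inr j \<Rightarrow> snd p $ j)"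
    for r :: "'a::finite + 'b::finite"
    by (cases r) (auto intro!: continuous_intros)
  then show ?thesis
    unfolding join_def case_prod_beta by (intro continuous_on_vec_lambda)
qed

lemma measurable_join [measurable]:
  "(\<lambda>(x, l). join x l) \<in> (lborel \<Otimes>\<^sub>M lborel) \<rightarrow>\<^sub>M borel"
  using borel_measurable_continuous_onI[OF continuous_join] by (simp add: borel_prod[symmetric] cong: measurable_cong_sets)

lemma emeasure_lborel_box_vec:
  fixes l u :: "real ^ 'k"
  assumes "\<And>i. l $ i \<le> u $ i"
  shows "emeasure lborel (box l u) = ennreal (\<Prod>i\<in>UNIV. u $ i - l $ i)"
proof -
  have "emeasure lborel (box l u) = ennreal (\<Prod>b\<in>Basis. (u - l) \<bullet> b)"
    by (rule emeasure_lborel_box) (use assms in \<open>auto simp: Basis_vec_def inner_axis\<close>)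
  then show ?thesis by (simp add: prod_Basis_vec inner_axis)
qed

text \<open>\<^const>\<open>join\<close> identifies the product of the two spaces with the space over the disjoint sum of the
indices; boxes correspond to products of boxes of the same volume.\<close>

lemma lborel_join:
  "distr (lborel \<Otimes>\<^sub>M lborel) borel (\<lambda>(x, l). join x l) = (lborel :: (real ^ ('m::finite + 'n::finite)) measure)"
proof (rule sym, rule lborel_eqI)
  fix l u :: "real ^ ('m + 'n)"
  assume "\<And>b. b \<in> Basis \<Longrightarrow> l \<bullet> b \<le> u \<bullet> b"
  from this[of "axis r 1" for r] have lu: "l $ r \<le> u $ r" for r by (simp add: inner_axis)
  let ?l1 = "\<chi> i. l $ Inl i" and ?u1 = "\<chi> i. u $ Inl i" and ?l2 = "\<chi> j. l $ Inr j" and ?u2 = "\<chi> j. u $ Inr j"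
  have all: "(\<forall>r. p r) \<longleftrightarrow> (\<forall>i. p (Inl i)) \<and> (\<forall>j. p (Inr j))" for p :: "'m + 'n \<Rightarrow> bool"
    by (metis sumE)
  have split: "(\<Prod>s\<in>UNIV. g s) = (\<Prod>i\<in>UNIV. g (Inl i)) * (\<Prod>j\<in>UNIV. g (Inr j))" for g :: "'m + 'n \<Rightarrow> real"
    by (subst UNIV_Plus_UNIV[symmetric], subst prod.Plus) (auto simp: comp_def)
  have "(\<lambda>(x, l). join x l) -` box l u = box ?l1 ?u1 \<times> box ?l2 ?u2"
    by (auto simp: mem_box_cart join_def all)
  then have "emeasure (distr (lborel \<Otimes>\<^sub>M lborel) borel (\<lambda>(x, l). join x l)) (box l u)
      = emeasure (lborel \<Otimes>\<^sub>M lborel) (box ?l1 ?u1 \<times> box ?l2 ?u2)"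
    by (subst emeasure_distr) (auto simp: space_pair_measure)
  also have "\<dots> = emeasure lborel (box ?l1 ?u1) * emeasure lborel (box ?l2 ?u2)"
    by (rule lborel.emeasure_pair_measure_Times) auto
  also have "\<dots> = ennreal (\<Prod>r\<in>UNIV. u $ r - l $ r)"
    using lu by (simp add: emeasure_lborel_box_vec split ennreal_mult[symmetric] prod_nonneg)
  also have "\<dots> = ennreal (\<Prod>b\<in>Basis. (u - l) \<bullet> b)" by (simp add: prod_Basis_vec inner_axis)
  finally show "emeasure (distr (lborel \<Otimes>\<^sub>M lborel) borel (\<lambda>(x, l). join x l)) (box l u)
      = ennreal (\<Prod>b\<in>Basis. (u - l) \<bullet> b)" .
qed simp

text \<open>Independence makes the product of the two densities a density of the joined vector, which is then
bounded by the product of the bounds. The two vectors have different types, so independence is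
stated for the generated sigma-algebras instead of as \<^const>\<open>prob_space.indep_var\<close>.\<close>

lemma (in prob_space) emeasure_join_le:
  fixes X :: "'a \<Rightarrow> real ^ 'm::finite" and L :: "'a \<Rightarrow> real ^ 'n::finite"
  assumes indep: "indep_set (sets (vimage_algebra (space M) X borel)) (sets (vimage_algebra (space M) L borel))"
    and X: "distributed M lborel X (\<lambda>x. ennreal (fX x))" and BX: "\<And>x. fX x \<le> BX"
    and L: "distributed M lborel L (\<lambda>l. ennreal (fL l))" and BL: "\<And>l. fL l \<le> BL"
    and E: "E \<in> sets borel"
  shows "emeasure M {\<omega> \<in> space M. join (X \<omega>) (L \<omega>) \<in> E} \<le> ennreal BX * ennreal BL * emeasure lborel E"
proof -
  have meas [measurable]: "X \<in> M \<rightarrow>\<^sub>M lborel" "L \<in> M \<rightarrow>\<^sub>M lborel"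
    using distributed_measurable[OF X] distributed_measurable[OF L] by auto
  interpret X: prob_space "distr M lborel X" by (rule prob_space_distr[OF meas(1)])
  interpret L: prob_space "distr M lborel L" by (rule prob_space_distr[OF meas(2)])
  have "distr M lborel X \<Otimes>\<^sub>M distr M lborel L = distr M (lborel \<Otimes>\<^sub>M lborel) (\<lambda>\<omega>. (X \<omega>, L \<omega>))"
  proof (rule pair_measure_eqI)
    fix A B assume "A \<in> sets (distr M lborel X)" "B \<in> sets (distr M lborel L)"
    then have AB [measurable]: "A \<in> sets borel" "B \<in> sets borel" by auto
    have "X -` A \<inter> space M \<in> sets (vimage_algebra (space M) X borel)"
      "L -` B \<inter> space M \<in> sets (vimage_algebra (space M) L borel)"
      by (auto intro!: in_vimage_algebra)
    from indep_setD[OF indep this]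
    have "emeasure M (X -` A \<inter> space M) * emeasure M (L -` B \<inter> space M)
        = emeasure M ((X -` A \<inter> space M) \<inter> (L -` B \<inter> space M))"
      by (simp add: emeasure_eq_measure ennreal_mult)
    also have "(X -` A \<inter> space M) \<inter> (L -` B \<inter> space M) = (\<lambda>\<omega>. (X \<omega>, L \<omega>)) -` (A \<times> B) \<inter> space M"
      by auto
    finally show "emeasure (distr M lborel X) A * emeasure (distr M lborel L) B
        = emeasure (distr M (lborel \<Otimes>\<^sub>M lborel) (\<lambda>\<omega>. (X \<omega>, L \<omega>))) (A \<times> B)"
      by (simp add: emeasure_distr[OF meas(1)] emeasure_distr[OF meas(2)] emeasure_distr)
  qed (auto simp: X.sigma_finite_measure_axioms L.sigma_finite_measure_axioms intro!: sets_pair_measure_cong)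
  from distributed_joint_indep'[OF _ _ X L this]
  have D: "distributed M (lborel \<Otimes>\<^sub>M lborel) (\<lambda>\<omega>. (X \<omega>, L \<omega>)) (\<lambda>(x, y). ennreal (fX x) * ennreal (fL y))"
    by (simp add: lborel.sigma_finite_measure_axioms)
  let ?A = "(\<lambda>(x, l). join x l) -` E \<inter> space (lborel \<Otimes>\<^sub>M lborel)"
  have A: "?A \<in> sets (lborel \<Otimes>\<^sub>M lborel)" by (rule measurable_sets[OF measurable_join E])
  have "emeasure M {\<omega> \<in> space M. join (X \<omega>) (L \<omega>) \<in> E} = emeasure M ((\<lambda>\<omega>. (X \<omega>, L \<omega>)) -` ?A \<inter> space M)"
    by (rule arg_cong[where f = "emeasure M"]) (auto simp: space_pair_measure)
  also have "\<dots> = (\<integral>\<^sup>+p. (case p of (x, y) \<Rightarrow> ennreal (fX x) * ennreal (fL y)) * indicator ?A p \<partial>(lborel \<Otimes>\<^sub>M lborel))"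
    by (rule distributed_emeasure[OF D A])
  also have "\<dots> \<le> (\<integral>\<^sup>+p. (ennreal BX * ennreal BL) * indicator ?A p \<partial>(lborel \<Otimes>\<^sub>M lborel))"
    by (intro nn_integral_mono) (auto intro!: mult_mono ennreal_leI BX BL split: prod.split)
  also have "\<dots> = ennreal BX * ennreal BL * emeasure (lborel \<Otimes>\<^sub>M lborel) ?A"
    using A by (simp add: nn_integral_cmult_indicator)
  also have "emeasure (lborel \<Otimes>\<^sub>M lborel) ?A = emeasure lborel E"
    by (subst lborel_join[symmetric], subst emeasure_distr) (use E in auto)
  finally show ?thesis .
qed


section \<open>Mean squared error\<close>

lemma ln_le_elog:
  assumes "0 < x" "ennreal x \<le> a"
  shows "ereal (ln x) \<le> elog a"
proof (cases a)
  case (real y)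
  then have "x \<le> y" using assms by (simp add: ennreal_le_iff2)
  then show ?thesis using assms real by (auto simp: elog_def ennreal_eq_0_iff)
next
  case top
  then show ?thesis by (simp add: elog_def)
qed

lemma emeasure_cube:
  fixes c :: "real ^ 'k"
  assumes "0 < s"
  shows "emeasure lborel {y. \<forall>r. \<bar>y $ r - c $ r\<bar> < s} = ennreal ((2 * s) ^ CARD('k))"
proof -
  have "{y. \<forall>r. \<bar>y $ r - c $ r\<bar> < s} = box (\<chi> r. c $ r - s) (\<chi> r. c $ r + s)"
    by (auto simp: mem_box_cart abs_less_iff algebra_simps)
  then show ?thesis using assms by (simp add: emeasure_lborel_box_vec prod_constant)
qed

lemma (in prob_space) distributed_AE_nonzero:
  assumes X: "distributed M N X (\<lambda>x. ennreal (f x))"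
  shows "AE \<omega> in M. f (X \<omega>) \<noteq> 0"
proof -
  note distributed_borel_measurable[OF X, measurable]
  have "AE \<omega> in M. ennreal (f (X \<omega>)) \<noteq> 0"
    by (subst distributed_AE2[OF X, of "\<lambda>x. ennreal (f x) \<noteq> 0"]) auto
  then show ?thesis by eventually_elim auto
qed

text \<open>Outside the cube of half side \<open>s\<close> around \<open>c\<close> the error is at least \<open>s\<close>. The almost sure
event \<open>G\<close> stands for a start in the region that the scheme is designed for: only there is the state,
in the role of \<open>Z\<close>, under control as a function of the outcome.\<close>

lemma (in prob_space) mse_ge_of_cube_prob:
  fixes Z :: "'a \<Rightarrow> real ^ 'k"
  assumes G: "{\<omega> \<in> space M. G \<omega>} \<in> events" and AE: "AE \<omega> in M. G \<omega>"
    and N: "{\<omega> \<in> space M. G \<omega> \<and> (\<forall>r. \<bar>Z \<omega> $ r - c $ r\<bar> < s)} \<in> events"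
    and half: "prob {\<omega> \<in> space M. G \<omega> \<and> (\<forall>r. \<bar>Z \<omega> $ r - c $ r\<bar> < s)} \<le> 1 / 2" (is "prob ?N \<le> _")
    and s: "0 < s"
  shows "ennreal (s\<^sup>2 / 2) \<le> mse M (\<lambda>\<omega>. Z \<omega> - c)"
proof -
  let ?A = "{\<omega> \<in> space M. G \<omega>} - ?N"
  have A: "?A \<in> events" using G N by auto
  have "prob {\<omega> \<in> space M. G \<omega>} = 1" using prob_Collect_eq_1[OF G] AE by simp
  then have "1 / 2 \<le> prob ?A"
    using half G N by (subst finite_measure_Diff) auto
  then have "ennreal (s\<^sup>2 * (1 / 2)) \<le> ennreal (s\<^sup>2 * prob ?A)"
    by (intro ennreal_leI mult_left_mono) auto
  also have "\<dots> = (\<integral>\<^sup>+\<omega>. ennreal (s\<^sup>2) * indicator ?A \<omega> \<partial>M)"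
    using A by (simp add: nn_integral_cmult_indicator emeasure_eq_measure ennreal_mult)
  also have "\<dots> \<le> mse M (\<lambda>\<omega>. Z \<omega> - c)"
    unfolding mse_def
  proof (rule nn_integral_mono)
    fix \<omega>
    show "ennreal (s\<^sup>2) * indicator ?A \<omega> \<le> ennreal ((norm (Z \<omega> - c))\<^sup>2)"
    proof (cases "\<omega> \<in> ?A")
      case True
      then obtain r where "s \<le> \<bar>Z \<omega> $ r - c $ r\<bar>" by (auto simp: not_less)
      then have "s \<le> norm (Z \<omega> - c)" using component_le_norm_cart[of "Z \<omega> - c" r] by simp
      then show ?thesis using True s by (auto intro!: ennreal_leI power_mono)
    qed simp
  qed
  finally show ?thesis by simp
qed

lemma liminf_ge_of_affine_bound:
  assumes "\<And>k. ereal (K - a * real k) \<le> f k"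
  shows "ereal (- a) \<le> liminf (\<lambda>k. ereal (1 / real (k + 1)) * f (k + 1))"
proof -
  have "(\<lambda>k. K / real (k + 1) - a) \<longlonglongrightarrow> 0 - a"
    by (intro tendsto_diff tendsto_const LIMSEQ_Suc[OF lim_const_over_n, of K, unfolded Suc_eq_plus1])
  then have "(\<lambda>k. ereal (K / real (k + 1) - a)) \<longlonglongrightarrow> ereal (- a)" by simp
  then have "ereal (- a) = liminf (\<lambda>k. ereal (K / real (k + 1) - a))"
    by (rule lim_imp_Liminf[OF sequentially_bot, symmetric])
  also have "\<dots> \<le> liminf (\<lambda>k. ereal (1 / real (k + 1)) * f (k + 1))"
  proof (rule Liminf_mono, rule always_eventually, rule allI)
    fix k
    have "ereal (K / real (k + 1) - a) = ereal (1 / real (k + 1)) * ereal (K - a * real (k + 1))"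
      by (simp add: field_simps)
    also have "\<dots> \<le> ereal (1 / real (k + 1)) * f (k + 1)"
      by (intro ereal_mult_left_mono assms) simp
    finally show "ereal (K / real (k + 1) - a) \<le> ereal (1 / real (k + 1)) * f (k + 1)" .
  qed
  finally show ?thesis .
qed

theorem theorem4:
  fixes P :: "('m::finite, 'n::finite) qnum"
    and \<mu> \<rho> :: real
    and S :: "('m + 'n, 's) scheme"
    and \<Omega> :: "'w measure"
    and X0 :: "'w \<Rightarrow> real ^ 'm" and L0 :: "'w \<Rightarrow> real ^ 'n"
    and fX :: "real ^ 'm \<Rightarrow> real" and fL :: "real ^ 'n \<Rightarrow> real"
    and xs :: "real ^ 'm" and ls :: "real ^ 'n"
    and T :: "real ^ ('m + 'n) ^ ('m + 'n)"
    and eps :: "nat \<Rightarrow> 'w \<Rightarrow> real ^ ('m + 'n)"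
  assumes "T = pd_matrix P \<mu>"
    and "eps = (\<lambda>k \<omega>. state P \<mu> S (join (X0 \<omega>) (L0 \<omega>)) k - join xs ls)"
    and "CARD('n) < CARD('m)"
    and "\<forall>i. qa P $ i > 0"
    and "0 < \<mu>" and "\<forall>i. \<mu> \<le> 1 / qa P $ i"
    and "primal_optimal P xs" and "dual_optimal P ls"
    and "invertible T"
    and "\<forall>z. eigenvalue (map_matrix complex_of_real T) z \<longrightarrow> cmod z < 1"
    and "prob_space \<Omega>"
    and "prob_space.indep_set \<Omega> (sets (vimage_algebra (space \<Omega>) X0 borel))
                                    (sets (vimage_algebra (space \<Omega>) L0 borel))"
    and "distributed \<Omega> lborel X0 (\<lambda>x. ennreal (fX x))" and "admissible_density fX"
    and "distributed \<Omega> lborel L0 (\<lambda>l. ennreal (fL l))" and "admissible_density fL"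
    and "\<forall>x l. fX x \<noteq> 0 \<longrightarrow> fL l \<noteq> 0 \<longrightarrow> join x l \<in> region S"
    and "quantization_scheme P \<mu> S"
    and "zoom_in P \<mu> S"
    and "\<forall>k. \<rho> = delta_max P \<mu> S k / delta_min P \<mu> S k"
  shows "liminf (\<lambda>k. ereal (1 / real (k + 1)) * elog (mse \<Omega> (eps (k + 1))))
         \<ge> (if \<exists>r. T $ r $ r = 0 then -\<infinity>
            else ereal (- (2 / real (CARD('m) + CARD('n)))
                          * ln (real (beta T \<rho>) / (\<Prod>r\<in>UNIV. \<bar>T $ r $ r\<bar>))))"
proof (cases "\<exists>r. T $ r $ r = 0")
  case True
  then show ?thesis by simp
next
  case False
  note T = assms(1)
  have diag: "pd_matrix P \<mu> $ r $ r \<noteq> 0" for r using False T by auto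
  interpret prob_space \<Omega> by fact
  define d where "d = (\<Prod>r\<in>UNIV. \<bar>T $ r $ r\<bar>)"
  define \<beta> where "\<beta> = beta T \<rho>"
  define n where "n = CARD('m) + CARD('n)"
  define Y where "Y \<omega> = join (X0 \<omega>) (L0 \<omega>)" for \<omega>
  have d: "0 < d" using False by (auto simp: d_def intro!: prod_pos)
  have n: "0 < n" "CARD('m + 'n) = n" by (simp_all add: n_def)

  obtain BX BL where "\<And>x. fX x \<le> BX" "\<And>l. fL l \<le> BL"
    using \<open>admissible_density fX\<close> \<open>admissible_density fL\<close> by (auto simp: admissible_density_def)
  then have BX: "\<And>x. fX x \<le> max BX 1" and BL: "\<And>l. fL l \<le> max BL 1" by (auto simp: le_max_iff_disj)
  define B where "B = max BX 1 * max BL 1"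
  have B: "0 < B" by (simp add: B_def)

  have vimage: "{\<omega> \<in> space \<Omega>. Y \<omega> \<in> E} \<in> events" if "E \<in> sets borel" for E
  proof -
    have "(\<lambda>\<omega>. (X0 \<omega>, L0 \<omega>)) \<in> \<Omega> \<rightarrow>\<^sub>M lborel \<Otimes>\<^sub>M lborel"
      using distributed_measurable[OF assms(13)] distributed_measurable[OF assms(15)] by simp
    from measurable_sets[OF measurable_compose[OF this measurable_join] that]
    show ?thesis by (simp add: Y_def vimage_def Int_def conj_commute)
  qed
  have AE_region: "AE \<omega> in \<Omega>. Y \<omega> \<in> region S"
    using distributed_AE_nonzero[OF assms(13)] distributed_AE_nonzero[OF assms(15)]
    by eventually_elim (use assms(17) in \<open>auto simp: Y_def\<close>)

  \<comment> \<open>The bound on the density of the state at time \<open>k\<close>, multiplied by \<open>d ^ k\<close> to avoid a quotient.\<close>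
  have bound: "{\<omega> \<in> space \<Omega>. Y \<omega> \<in> region S \<and> state P \<mu> S (Y \<omega>) k \<in> E} \<in> events"
      "ennreal (d ^ k) * emeasure \<Omega> {\<omega> \<in> space \<Omega>. Y \<omega> \<in> region S \<and> state P \<mu> S (Y \<omega>) k \<in> E}
         \<le> ennreal B * (of_nat (\<beta> ^ k) * emeasure lborel E)"
    if E: "E \<in> sets borel" for k E
  proof -
    let ?D = "{y \<in> region S. state P \<mu> S y k \<in> E}"
    note D = emeasure_state_vimage_le[OF assms(18,19) assms(9)[unfolded T] assms(20)[rule_format] diag E,
        of k, folded T, folded d_def \<beta>_def]
    have eq: "{\<omega> \<in> space \<Omega>. Y \<omega> \<in> region S \<and> state P \<mu> S (Y \<omega>) k \<in> E} = {\<omega> \<in> space \<Omega>. Y \<omega> \<in> ?D}" by auto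
    show "{\<omega> \<in> space \<Omega>. Y \<omega> \<in> region S \<and> state P \<mu> S (Y \<omega>) k \<in> E} \<in> events"
      unfolding eq by (rule vimage[OF D(1)])
    have "emeasure \<Omega> {\<omega> \<in> space \<Omega>. Y \<omega> \<in> ?D} \<le> ennreal B * emeasure lborel ?D"
      using emeasure_join_le[OF assms(12,13) BX assms(15) BL D(1)]
      by (simp add: Y_def B_def ennreal_mult)
    then have "ennreal (d ^ k) * emeasure \<Omega> {\<omega> \<in> space \<Omega>. Y \<omega> \<in> ?D}
        \<le> ennreal (d ^ k) * (ennreal B * emeasure lborel ?D)" by (rule mult_left_mono) simp
    also have "\<dots> = ennreal B * (ennreal (d ^ k) * emeasure lborel ?D)" by (rule mult.left_commute)
    also have "\<dots> \<le> ennreal B * (of_nat (\<beta> ^ k) * emeasure lborel E)"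
      by (intro mult_left_mono D(2)) simp
    finally show "ennreal (d ^ k) * emeasure \<Omega> {\<omega> \<in> space \<Omega>. Y \<omega> \<in> region S \<and> state P \<mu> S (Y \<omega>) k \<in> E}
         \<le> ennreal B * (of_nat (\<beta> ^ k) * emeasure lborel E)" unfolding eq .
  qed

  have regionM: "{\<omega> \<in> space \<Omega>. Y \<omega> \<in> region S} \<in> events" using bound(1)[of UNIV 0] by simp
  have "emeasure \<Omega> {\<omega> \<in> space \<Omega>. Y \<omega> \<in> region S} = 1"
    using prob_Collect_eq_1[OF regionM] AE_region by (simp add: emeasure_eq_measure)
  \<comment> \<open>If \<open>\<beta>\<close> were 0, the bound for time 1 and the whole space would read \<open>d \<le> B * (0 * \<infinity>) = 0\<close>.\<close>
  then have "\<beta> \<noteq> 0" using bound(2)[of UNIV 1] d by (cases "\<beta> = 0") auto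
  then have \<beta>: "0 < \<beta>" by simp

  have "ereal (- 3 * ln 2 - 2 / n * ln (2 * B) - (2 / n * ln (\<beta> / d)) * real k) \<le> elog (mse \<Omega> (eps k))" for k
  proof -
    \<comment> \<open>The volume \<open>v\<close> is chosen such that a cube of this volume has probability at most 1/2; its side
      is \<open>2 * s\<close>.\<close>
    define v where "v = d ^ k / (2 * B * real \<beta> ^ k)"
    define s where "s = root n v / 2"
    have v: "0 < v" using d B \<beta> by (simp add: v_def)
    have s: "0 < s" using v n by (simp add: s_def)
    let ?E = "{y. \<forall>r. \<bar>y $ r - join xs ls $ r\<bar> < s}"
    have "?E = box (\<chi> r. join xs ls $ r - s) (\<chi> r. join xs ls $ r + s)"
      by (auto simp: mem_box_cart abs_less_iff algebra_simps)
    then have E: "?E \<in> sets borel" by simp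
    have sn: "(2 * s) ^ n = v" using v n by (simp add: s_def)
    let ?N = "{\<omega> \<in> space \<Omega>. Y \<omega> \<in> region S \<and> state P \<mu> S (Y \<omega>) k \<in> ?E}"
    have "emeasure lborel ?E = ennreal v"
      using emeasure_cube[OF s, of "join xs ls"] unfolding n(2) sn .
    then have "ennreal (d ^ k * prob ?N) \<le> ennreal (B * (real \<beta> ^ k * v))"
      using bound(2)[OF E, of k] B d v
      by (simp add: emeasure_eq_measure ennreal_mult ennreal_of_nat_eq_real_of_nat)
    then have "d ^ k * prob ?N \<le> B * (real \<beta> ^ k * v)"
      using B v by (subst (asm) ennreal_le_iff) auto
    also have "\<dots> = d ^ k * (1 / 2)" using B \<beta> by (simp add: v_def field_simps)
    finally have half: "prob ?N \<le> 1 / 2" using d by (simp add: mult_le_cancel_left_pos)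
    have "ennreal (s\<^sup>2 / 2) \<le> mse \<Omega> (eps k)"
      using mse_ge_of_cube_prob[OF regionM AE_region, where Z = "\<lambda>\<omega>. state P \<mu> S (Y \<omega>) k" and c = "join xs ls" and s = s]
        bound(1)[OF E, of k] half s by (simp add: assms(2) Y_def)
    then have "ereal (ln (s\<^sup>2 / 2)) \<le> elog (mse \<Omega> (eps k))" using s by (intro ln_le_elog) simp
    moreover have "ln (s\<^sup>2 / 2) = - 3 * ln 2 - 2 / n * ln (2 * B) - (2 / n * ln (\<beta> / d)) * real k"
    proof -
      have v_eq: "ln v = k * ln d - ln (2 * B) - k * ln \<beta>"
        using d B \<beta> by (simp add: v_def ln_div ln_mult ln_realpow)
      have s_eq: "ln s = ln v / n - ln 2" using v n by (simp add: s_def ln_div ln_root)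
      have ratio: "ln (\<beta> / d) = ln \<beta> - ln d" using d \<beta> by (simp add: ln_div)
      have "ln (s\<^sup>2 / 2) = 2 * ln s - ln 2" using s by (simp add: ln_div ln_realpow)
      then show ?thesis unfolding s_eq v_eq ratio
        by (simp add: diff_divide_distrib add_divide_distrib algebra_simps)
    qed
    ultimately show ?thesis by simp
  qed
  from liminf_ge_of_affine_bound[OF this] False show ?thesis
    by (simp add: n_def \<beta>_def d_def)
qed

end
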